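(* Let $\mathscr{C}$ be a category with a class of subobjects $\mathcal{S}$, let $\mathcal{P}(\mathscr{C})$ be the category of partial maps with the order $\preceq$, and let $(\mathcal{L},\mathcal{R})$ be an oplax weak factorisation system on $\mathcal{P}(\mathscr{C})$. Let $\mathcal{L}_{\mathbf{Tot}}$ and $\mathcal{R}_{\mathbf{Tot}}$ be the classes of total maps in $\mathcal{L}$ and in $\mathcal{R}$ respectively, regarded as classes of morphisms of $\mathscr{C}$. Then $(\mathcal{L}_{\mathbf{Tot}},\mathcal{R}_{\mathbf{Tot}})$ is a weak factorisation system for $\mathscr{C}$.
   Context: Partial maps: $\mathcal{S}$ is a class of monomorphisms of $\mathscr{C}$ closed under composition, stable under pullback and containing all sections (split monomorphisms); $\mathscr{C}$ has pullbacks along morphisms in $\mathcal{S}$. $\mathcal{P}(\mathscr{C})$ has the objects of $\mathscr{C}$; a morphism (partial map) $f:A\to B$ is a span $(\sigma_f,\varphi_f)$ with $\sigma_f:D_f\rightarrowtail A$ in $\mathcal{S}$ and $\varphi_f:D_f\to B$ in $\mathscr{C}$ (spans being identified up to isomorphism); composition is by pullback: $D_{g\cdot f}$ is the pullback of $\sigma_g$ along $\varphi_f$, $\sigma_{g\cdot f}=\sigma_f\cdot\varphi_f^*(\sigma_g)$, $\varphi_{g\cdot f}=\varphi_g\cdot\sigma_g^*(\varphi_f)$. It is ordered by: $f\preceq g$ iff there is $s:D_f\rightarrowtail D_g$ in $\mathcal{S}$ with $\sigma_f=\sigma_g\cdot s$ and $\varphi_f=\varphi_g\cdot s$. A partial map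 is total if its partial domain is its whole domain ($\sigma_f$ is an isomorphism); total maps are identified with the morphisms of $\mathscr{C}$. In $\mathcal{P}(\mathscr{C})$, an oplax square $(u,v):f\to g$, for $f:A\to B$, $g:C\to D$, is a pair $u:A\to C$, $v:B\to D$ with $v\cdot f\preceq g\cdot u$. $f\perp_{\mathrm{oplax}}g$ means that for every oplax square $(u,v):f\to g$ there is $d:B\to C$ with $d\cdot f\preceq u$ and $v\preceq g\cdot d$. An oplax weak factorisation system is a pair $(\mathcal{L},\mathcal{R})$ of classes of morphisms with $\mathcal{R}=\{g\mid f\perp_{\mathrm{oplax}}g\ \forall f\in\mathcal{L}\}$, $\mathcal{L}=\{f\mid f\perp_{\mathrm{oplax}}g\ \forall g\in\mathcal{R}\}$, such that every morphism factors as $r\cdot l$ with $l\in\mathcal{L}$, $r\in\mathcal{R}$. A weak factorisation system on $\mathscr{C}$ is the ordinary notion: each class is exactly the class of morphisms weakly orthogonal (existence, not uniqueness, of diagonal fillers for commutative squares) to the other, and every morphism factors as a left-class morphism followed by a right-class morphism. *)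

theory Defs
  imports Main
begin

(* All axioms are relativised to Ob and Arr; nothing is assumed about Dom, Cod, Comp outside
   Arr or on non-composable pairs. *)

record ('o, 'm) cat =
  Ob :: "'o set"
  Arr :: "'m set"
  Dom :: "'m \<Rightarrow> 'o"
  Cod :: "'m \<Rightarrow> 'o"
  Ide :: "'o \<Rightarrow> 'm"
  Comp :: "'m \<Rightarrow> 'm \<Rightarrow> 'm" (infixl "\<cdot>\<index>" 70)

definition hom :: "('o, 'm, 'x) cat_scheme \<Rightarrow> 'o \<Rightarrow> 'o \<Rightarrow> 'm set" where
  "hom C a b = {f \<in> Arr C. Dom C f = a \<and> Cod C f = b}"

locale category =
  fixes C :: "('o, 'm, 'x) cat_scheme" (structure)
  assumes Dom_Ob: "f \<in> Arr C \<Longrightarrow> Dom C f \<in> Ob C"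
    and Cod_Ob: "f \<in> Arr C \<Longrightarrow> Cod C f \<in> Ob C"
    and Ide_hom: "a \<in> Ob C \<Longrightarrow> Ide C a \<in> hom C a a"
    and Comp_hom: "f \<in> Arr C \<Longrightarrow> g \<in> Arr C \<Longrightarrow> Dom C g = Cod C f
      \<Longrightarrow> g \<cdot> f \<in> hom C (Dom C f) (Cod C g)"
    and Comp_Ide: "f \<in> Arr C \<Longrightarrow> f \<cdot> Ide C (Dom C f) = f"
    and Ide_Comp: "f \<in> Arr C \<Longrightarrow> Ide C (Cod C f) \<cdot> f = f"
    and Comp_assoc: "f \<in> Arr C \<Longrightarrow> g \<in> Arr C \<Longrightarrow> h \<in> Arr C
      \<Longrightarrow> Dom C g = Cod C f \<Longrightarrow> Dom C h = Cod C g \<Longrightarrow> (h \<cdot> g) \<cdot> f = h \<cdot> (g \<cdot> f)"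

definition monic :: "('o, 'm, 'x) cat_scheme \<Rightarrow> 'm \<Rightarrow> bool" where
  "monic C m \<longleftrightarrow> m \<in> Arr C \<and>
     (\<forall>a. \<forall>f \<in> hom C a (Dom C m). \<forall>g \<in> hom C a (Dom C m).
        m \<cdot>\<^bsub>C\<^esub> f = m \<cdot>\<^bsub>C\<^esub> g \<longrightarrow> f = g)"

definition split_monic :: "('o, 'm, 'x) cat_scheme \<Rightarrow> 'm \<Rightarrow> bool" where
  "split_monic C m \<longleftrightarrow> m \<in> Arr C \<and>
     (\<exists>r \<in> hom C (Cod C m) (Dom C m). r \<cdot>\<^bsub>C\<^esub> m = Ide C (Dom C m))"

definition is_iso :: "('o, 'm, 'x) cat_scheme \<Rightarrow> 'm \<Rightarrow> bool" where
  "is_iso C i \<longleftrightarrow> i \<in> Arr C \<and>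
     (\<exists>j \<in> hom C (Cod C i) (Dom C i).
        j \<cdot>\<^bsub>C\<^esub> i = Ide C (Dom C i) \<and> i \<cdot>\<^bsub>C\<^esub> j = Ide C (Cod C i))"

(* The square f . p = g . q is a pullback of the cospan (f, g); p is the pullback of g along f. *)
definition is_pullback ::
    "('o, 'm, 'x) cat_scheme \<Rightarrow> 'm \<Rightarrow> 'm \<Rightarrow> 'm \<Rightarrow> 'm \<Rightarrow> bool" where
  "is_pullback C p q f g \<longleftrightarrow>
     f \<in> Arr C \<and> g \<in> Arr C \<and> Cod C f = Cod C g \<and>
     p \<in> Arr C \<and> q \<in> Arr C \<and> Dom C p = Dom C q \<and> Cod C p = Dom C f \<and> Cod C q = Dom C g \<and>
     f \<cdot>\<^bsub>C\<^esub> p = g \<cdot>\<^bsub>C\<^esub> q \<and>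
     (\<forall>a. \<forall>x \<in> hom C a (Dom C f). \<forall>y \<in> hom C a (Dom C g).
        f \<cdot>\<^bsub>C\<^esub> x = g \<cdot>\<^bsub>C\<^esub> y \<longrightarrow>
        (\<exists>!h. h \<in> hom C a (Dom C p) \<and> p \<cdot>\<^bsub>C\<^esub> h = x \<and> q \<cdot>\<^bsub>C\<^esub> h = y))"

locale subobject_class = category +
  fixes S :: "'m set"
  assumes S_monic: "s \<in> S \<Longrightarrow> monic C s"
    and S_Comp: "s \<in> S \<Longrightarrow> t \<in> S \<Longrightarrow> Dom C t = Cod C s \<Longrightarrow> t \<cdot> s \<in> S"
    and S_pullback: "s \<in> S \<Longrightarrow> is_pullback C p q f s \<Longrightarrow> p \<in> S"
    and S_split_monic: "split_monic C s \<Longrightarrow> s \<in> S"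
    and ex_pullback: "s \<in> S \<Longrightarrow> f \<in> Arr C \<Longrightarrow> Cod C f = Cod C s \<Longrightarrow> \<exists>p q. is_pullback C p q f s"


definition weak_orth :: "('o, 'm, 'x) cat_scheme \<Rightarrow> 'm \<Rightarrow> 'm \<Rightarrow> bool" where
  "weak_orth C f g \<longleftrightarrow>
     (\<forall>u \<in> hom C (Dom C f) (Dom C g). \<forall>v \<in> hom C (Cod C f) (Cod C g).
        v \<cdot>\<^bsub>C\<^esub> f = g \<cdot>\<^bsub>C\<^esub> u \<longrightarrow>
        (\<exists>d \<in> hom C (Cod C f) (Dom C g). d \<cdot>\<^bsub>C\<^esub> f = u \<and> g \<cdot>\<^bsub>C\<^esub> d = v))"

definition weak_fact_system :: "('o, 'm, 'x) cat_scheme \<Rightarrow> 'm set \<Rightarrow> 'm set \<Rightarrow> bool" where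
  "weak_fact_system C L R \<longleftrightarrow>
     R = {g \<in> Arr C. \<forall>f \<in> L. weak_orth C f g} \<and>
     L = {f \<in> Arr C. \<forall>g \<in> R. weak_orth C f g} \<and>
     (\<forall>f \<in> Arr C. \<exists>l \<in> L. \<exists>r \<in> R. Dom C r = Cod C l \<and> f = r \<cdot>\<^bsub>C\<^esub> l)"


record ('o, 'm) ord_cat = "('o, 'm) cat" +
  le :: "'m \<Rightarrow> 'm \<Rightarrow> bool" (infix "\<preceq>\<index>" 50)

definition oplax_square ::
    "('o, 'm, 'x) ord_cat_scheme \<Rightarrow> 'm \<Rightarrow> 'm \<Rightarrow> 'm \<Rightarrow> 'm \<Rightarrow> bool" where
  "oplax_square P f g u v \<longleftrightarrow>
     u \<in> hom P (Dom P f) (Dom P g) \<and> v \<in> hom P (Cod P f) (Cod P g) \<and>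
     v \<cdot>\<^bsub>P\<^esub> f \<preceq>\<^bsub>P\<^esub> g \<cdot>\<^bsub>P\<^esub> u"

definition oplax_orth :: "('o, 'm, 'x) ord_cat_scheme \<Rightarrow> 'm \<Rightarrow> 'm \<Rightarrow> bool" where
  "oplax_orth P f g \<longleftrightarrow>
     (\<forall>u v. oplax_square P f g u v \<longrightarrow>
        (\<exists>d \<in> hom P (Cod P f) (Dom P g). d \<cdot>\<^bsub>P\<^esub> f \<preceq>\<^bsub>P\<^esub> u \<and> v \<preceq>\<^bsub>P\<^esub> g \<cdot>\<^bsub>P\<^esub> d))"

definition oplax_weak_fact_system ::
    "('o, 'm, 'x) ord_cat_scheme \<Rightarrow> 'm set \<Rightarrow> 'm set \<Rightarrow> bool" where
  "oplax_weak_fact_system P L R \<longleftrightarrow>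
     R = {g \<in> Arr P. \<forall>f \<in> L. oplax_orth P f g} \<and>
     L = {f \<in> Arr P. \<forall>g \<in> R. oplax_orth P f g} \<and>
     (\<forall>f \<in> Arr P. \<exists>l \<in> L. \<exists>r \<in> R. Dom P r = Cod P l \<and> f = r \<cdot>\<^bsub>P\<^esub> l)"


(* Partial maps.  A span (sigma, phi) is a pair of arrows with common domain;
   a partial map is an isomorphism class of spans, i.e. a set of pairs. *)

definition spans :: "('o, 'm, 'x) cat_scheme \<Rightarrow> 'm set \<Rightarrow> ('m \<times> 'm) set" where
  "spans C S = {(\<sigma>, \<phi>). \<sigma> \<in> S \<and> \<sigma> \<in> Arr C \<and> \<phi> \<in> Arr C \<and> Dom C \<sigma> = Dom C \<phi>}"

definition span_iso ::
    "('o, 'm, 'x) cat_scheme \<Rightarrow> 'm set \<Rightarrow> (('m \<times> 'm) \<times> ('m \<times> 'm)) set" where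
  "span_iso C S = {((\<sigma>, \<phi>), (\<sigma>', \<phi>')).
     (\<sigma>, \<phi>) \<in> spans C S \<and> (\<sigma>', \<phi>') \<in> spans C S \<and>
     (\<exists>i. is_iso C i \<and> i \<in> hom C (Dom C \<sigma>) (Dom C \<sigma>') \<and>
        \<sigma> = \<sigma>' \<cdot>\<^bsub>C\<^esub> i \<and> \<phi> = \<phi>' \<cdot>\<^bsub>C\<^esub> i)}"

definition span_class ::
    "('o, 'm, 'x) cat_scheme \<Rightarrow> 'm set \<Rightarrow> 'm \<times> 'm \<Rightarrow> ('m \<times> 'm) set" where
  "span_class C S s = span_iso C S `` {s}"

(* All composites of representatives, over all choices of pullback; for composable G, F
   this set is exactly one isomorphism class (see Par_Comp_class below). *)
definition par_comp ::
    "('o, 'm, 'x) cat_scheme \<Rightarrow> ('m \<times> 'm) set \<Rightarrow> ('m \<times> 'm) set \<Rightarrow> ('m \<times> 'm) set" where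
  "par_comp C G F = {(\<sigma> \<cdot>\<^bsub>C\<^esub> p, \<psi> \<cdot>\<^bsub>C\<^esub> q) | \<sigma> \<phi> \<tau> \<psi> p q.
     (\<sigma>, \<phi>) \<in> F \<and> (\<tau>, \<psi>) \<in> G \<and> is_pullback C p q \<phi> \<tau>}"

definition par_le ::
    "('o, 'm, 'x) cat_scheme \<Rightarrow> 'm set \<Rightarrow> ('m \<times> 'm) set \<Rightarrow> ('m \<times> 'm) set \<Rightarrow> bool" where
  "par_le C S F G \<longleftrightarrow>
     (\<exists>(\<sigma>, \<phi>) \<in> F. \<exists>(\<tau>, \<psi>) \<in> G. \<exists>s \<in> S. s \<in> hom C (Dom C \<sigma>) (Dom C \<tau>) \<and>
        \<sigma> = \<tau> \<cdot>\<^bsub>C\<^esub> s \<and> \<phi> = \<psi> \<cdot>\<^bsub>C\<^esub> s)"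

(* All representatives of a partial map have the same endpoints, so the_elem is well defined. *)
definition Par :: "('o, 'm, 'x) cat_scheme \<Rightarrow> 'm set \<Rightarrow> ('o, ('m \<times> 'm) set) ord_cat" where
  "Par C S = \<lparr>
     Ob = Ob C,
     Arr = spans C S // span_iso C S,
     Dom = (\<lambda>F. the_elem ((\<lambda>(\<sigma>, \<phi>). Cod C \<sigma>) ` F)),
     Cod = (\<lambda>F. the_elem ((\<lambda>(\<sigma>, \<phi>). Cod C \<phi>) ` F)),
     Ide = (\<lambda>a. span_class C S (Ide C a, Ide C a)),
     Comp = par_comp C,
     le = par_le C S\<rparr>"

definition total_par :: "('o, 'm, 'x) cat_scheme \<Rightarrow> ('m \<times> 'm) set \<Rightarrow> bool" where
  "total_par C F \<longleftrightarrow> (\<exists>(\<sigma>, \<phi>) \<in> F. is_iso C \<sigma>)"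

(* The identification of arrows of C with total maps; see bij_betw_of_arr. *)
definition of_arr :: "('o, 'm, 'x) cat_scheme \<Rightarrow> 'm set \<Rightarrow> 'm \<Rightarrow> ('m \<times> 'm) set" where
  "of_arr C S m = span_class C S (Ide C (Dom C m), m)"

definition Tot :: "('o, 'm, 'x) cat_scheme \<Rightarrow> 'm set \<Rightarrow> ('m \<times> 'm) set set \<Rightarrow> 'm set" where
  "Tot C S K = {m \<in> Arr C. of_arr C S m \<in> {F \<in> K. total_par C F}}"


(* Checks of the definitions: composition of classes is well defined, Par C S is a category,
   and the total maps are exactly the arrows of C. *)

context category
begin

lemma Comp_Arr: "f \<in> Arr C \<Longrightarrow> g \<in> Arr C \<Longrightarrow> Dom C g = Cod C f \<Longrightarrow> g \<cdot> f \<in> Arr C"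
  and Dom_Comp: "f \<in> Arr C \<Longrightarrow> g \<in> Arr C \<Longrightarrow> Dom C g = Cod C f \<Longrightarrow> Dom C (g \<cdot> f) = Dom C f"
  and Cod_Comp: "f \<in> Arr C \<Longrightarrow> g \<in> Arr C \<Longrightarrow> Dom C g = Cod C f \<Longrightarrow> Cod C (g \<cdot> f) = Cod C g"
  using Comp_hom by (auto simp: hom_def)

lemma Ide_Arr: "a \<in> Ob C \<Longrightarrow> Ide C a \<in> Arr C"
  and Dom_Ide: "a \<in> Ob C \<Longrightarrow> Dom C (Ide C a) = a"
  and Cod_Ide: "a \<in> Ob C \<Longrightarrow> Cod C (Ide C a) = a"
  using Ide_hom by (auto simp: hom_def)

lemmas cat_simps = Comp_Arr Dom_Comp Cod_Comp Ide_Arr Dom_Ide Cod_Ide Comp_Ide Ide_Comp Comp_assoc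
  Dom_Ob Cod_Ob

lemma is_isoE:
  assumes "is_iso C i"
  obtains j where "is_iso C j" "j \<in> Arr C" "i \<in> Arr C" "Dom C j = Cod C i" "Cod C j = Dom C i"
    "j \<cdot> i = Ide C (Dom C i)" "i \<cdot> j = Ide C (Cod C i)"
  using assms by (auto simp: is_iso_def hom_def)

lemma is_isoI:
  assumes "i \<in> Arr C" "j \<in> Arr C" "Dom C j = Cod C i" "Cod C j = Dom C i"
    "j \<cdot> i = Ide C (Dom C i)" "i \<cdot> j = Ide C (Cod C i)"
  shows "is_iso C i"
  using assms by (auto simp: is_iso_def hom_def)

lemma is_iso_Ide: "a \<in> Ob C \<Longrightarrow> is_iso C (Ide C a)"
  using Comp_Ide[of "Ide C a"] by (intro is_isoI[where j = "Ide C a"]) (auto simp: Ide_Arr Dom_Ide Cod_Ide)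

lemma iso_cancel:
  assumes "j \<in> Arr C" "i \<in> Arr C" "Dom C j = Cod C i" "Cod C j = Dom C i"
    "i \<cdot> j = Ide C (Cod C i)" "x \<in> Arr C" "Dom C x = Cod C i"
  shows "(x \<cdot> i) \<cdot> j = x"
  using assms Comp_assoc[of j i x] Comp_Ide[of x] by simp

lemma iso_cancel_left:
  assumes "j \<in> Arr C" "i \<in> Arr C" "Dom C j = Cod C i" "Cod C j = Dom C i"
    "j \<cdot> i = Ide C (Dom C i)" "x \<in> Arr C" "Cod C x = Dom C i"
  shows "j \<cdot> (i \<cdot> x) = x"
  using assms Comp_assoc[of x i j] Ide_Comp[of x] by simp

lemma is_iso_Comp:
  assumes "is_iso C i" "is_iso C k" "Dom C k = Cod C i"
  shows "is_iso C (k \<cdot> i)"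
proof -
  obtain j where j: "j \<in> Arr C" "i \<in> Arr C" "Dom C j = Cod C i" "Cod C j = Dom C i"
    "j \<cdot> i = Ide C (Dom C i)" "i \<cdot> j = Ide C (Cod C i)" using assms(1) by (rule is_isoE)
  obtain l where l: "l \<in> Arr C" "k \<in> Arr C" "Dom C l = Cod C k" "Cod C l = Dom C k"
    "l \<cdot> k = Ide C (Dom C k)" "k \<cdot> l = Ide C (Cod C k)" using assms(2) by (rule is_isoE)
  have "(j \<cdot> l) \<cdot> (k \<cdot> i) = j \<cdot> (l \<cdot> (k \<cdot> i))"
    using j l assms(3) by (intro Comp_assoc) (simp_all add: Comp_Arr Cod_Comp)
  also have "l \<cdot> (k \<cdot> i) = i" using j l assms(3) by (intro iso_cancel_left) simp_all
  finally have 1: "(j \<cdot> l) \<cdot> (k \<cdot> i) = Ide C (Dom C i)" using j by simp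
  have "(k \<cdot> i) \<cdot> (j \<cdot> l) = k \<cdot> (i \<cdot> (j \<cdot> l))"
    using j l assms(3) by (intro Comp_assoc) (simp_all add: Comp_Arr Cod_Comp)
  also have "i \<cdot> (j \<cdot> l) = l" using j l assms(3) by (intro iso_cancel_left) simp_all
  finally have 2: "(k \<cdot> i) \<cdot> (j \<cdot> l) = Ide C (Cod C k)" using l by simp
  show ?thesis using j l assms(3) 1 2
    by (intro is_isoI[where j = "j \<cdot> l"]) (simp_all add: Comp_Arr Dom_Comp Cod_Comp)
qed

lemma pullback_sym: "is_pullback C p q f g \<Longrightarrow> is_pullback C q p g f"
  unfolding is_pullback_def by (auto 0 0) metis+

lemma pullbackD:
  assumes "is_pullback C p q f g"
  shows "f \<in> Arr C" "g \<in> Arr C" "p \<in> Arr C" "q \<in> Arr C" "Cod C f = Cod C g" "Dom C p = Dom C q"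
    "Cod C p = Dom C f" "Cod C q = Dom C g" "f \<cdot> p = g \<cdot> q"
  using assms by (auto simp: is_pullback_def)

lemma pullback_lift:
  assumes "is_pullback C p q f g" "x \<in> Arr C" "y \<in> Arr C" "Dom C x = Dom C y"
    "Cod C x = Dom C f" "Cod C y = Dom C g" "f \<cdot> x = g \<cdot> y"
  shows "\<exists>h \<in> Arr C. Dom C h = Dom C x \<and> Cod C h = Dom C p \<and> p \<cdot> h = x \<and> q \<cdot> h = y"
proof -
  have hx: "x \<in> hom C (Dom C x) (Dom C f)" and hy: "y \<in> hom C (Dom C x) (Dom C g)"
    using assms by (auto simp: hom_def)
  have "\<exists>!h. h \<in> hom C (Dom C x) (Dom C p) \<and> p \<cdot> h = x \<and> q \<cdot> h = y"
    using assms(1,7) hx hy unfolding is_pullback_def by blast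
  then show ?thesis by (auto simp: hom_def)
qed

lemma pullback_unique:
  assumes "is_pullback C p q f g" "h \<in> Arr C" "k \<in> Arr C" "Dom C h = Dom C k"
    "Cod C h = Dom C p" "Cod C k = Dom C p" "p \<cdot> h = p \<cdot> k" "q \<cdot> h = q \<cdot> k"
  shows "h = k"
proof -
  note D = pullbackD[OF assms(1)]
  have e: "f \<cdot> (p \<cdot> k) = g \<cdot> (q \<cdot> k)"
    using D assms(2-6) Comp_assoc[of k p f] Comp_assoc[of k q g] by simp
  have "p \<cdot> k \<in> hom C (Dom C k) (Dom C f)" "q \<cdot> k \<in> hom C (Dom C k) (Dom C g)"
    using D assms(2-6) by (auto simp: hom_def cat_simps)
  then have "\<exists>!h. h \<in> hom C (Dom C k) (Dom C p) \<and> p \<cdot> h = p \<cdot> k \<and> q \<cdot> h = q \<cdot> k"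
    using assms(1) e unfolding is_pullback_def by blast
  then show ?thesis using assms(2-8) by (auto simp: hom_def)
qed

lemma pullbackI:
  assumes "f \<in> Arr C" "g \<in> Arr C" "p \<in> Arr C" "q \<in> Arr C" "Cod C f = Cod C g" "Dom C p = Dom C q"
    "Cod C p = Dom C f" "Cod C q = Dom C g" "f \<cdot> p = g \<cdot> q"
    and ex: "\<And>x y. x \<in> Arr C \<Longrightarrow> y \<in> Arr C \<Longrightarrow> Dom C x = Dom C y \<Longrightarrow> Cod C x = Dom C f
      \<Longrightarrow> Cod C y = Dom C g \<Longrightarrow> f \<cdot> x = g \<cdot> y
      \<Longrightarrow> \<exists>h \<in> Arr C. Dom C h = Dom C x \<and> Cod C h = Dom C p \<and> p \<cdot> h = x \<and> q \<cdot> h = y"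
    and un: "\<And>h k. h \<in> Arr C \<Longrightarrow> k \<in> Arr C \<Longrightarrow> Dom C h = Dom C k \<Longrightarrow> Cod C h = Dom C p
      \<Longrightarrow> Cod C k = Dom C p \<Longrightarrow> p \<cdot> h = p \<cdot> k \<Longrightarrow> q \<cdot> h = q \<cdot> k \<Longrightarrow> h = k"
  shows "is_pullback C p q f g"
  unfolding is_pullback_def
proof (intro conjI allI ballI impI)
  fix a x y
  assume x: "x \<in> hom C a (Dom C f)" and y: "y \<in> hom C a (Dom C g)" and e: "f \<cdot> x = g \<cdot> y"
  then have "\<exists>h \<in> Arr C. Dom C h = Dom C x \<and> Cod C h = Dom C p \<and> p \<cdot> h = x \<and> q \<cdot> h = y"
    by (intro ex) (auto simp: hom_def)
  then obtain h where h: "h \<in> Arr C" "Dom C h = Dom C x" "Cod C h = Dom C p" "p \<cdot> h = x" "q \<cdot> h = y"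
    by blast
  show "\<exists>!h. h \<in> hom C a (Dom C p) \<and> p \<cdot> h = x \<and> q \<cdot> h = y"
  proof (rule ex1I[of _ h])
    show "h \<in> hom C a (Dom C p) \<and> p \<cdot> h = x \<and> q \<cdot> h = y" using h x by (auto simp: hom_def)
    show "k = h" if "k \<in> hom C a (Dom C p) \<and> p \<cdot> k = x \<and> q \<cdot> k = y" for k
    proof (rule un)
      show "k \<in> Arr C" "h \<in> Arr C" "Cod C k = Dom C p" "Cod C h = Dom C p"
        using that h(1,3) by (simp_all add: hom_def)
      show "Dom C k = Dom C h" using that h(2) x by (simp add: hom_def)
      show "p \<cdot> k = p \<cdot> h" "q \<cdot> k = q \<cdot> h" using that h(4,5) by simp_all
    qed
  qed
qed (use assms in auto)

lemma pullback_paste: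
  assumes 1: "is_pullback C p q f g" and 2: "is_pullback C t w q r"
  shows "is_pullback C (p \<cdot> t) w f (g \<cdot> r)"
proof (rule pullbackI)
  note D = pullbackD[OF 1] pullbackD[OF 2]
  have "f \<cdot> (p \<cdot> t) = (g \<cdot> q) \<cdot> t" using D Comp_assoc[of t p f] by simp
  also have "\<dots> = g \<cdot> (r \<cdot> w)" using D Comp_assoc[of t q g] by simp
  also have "\<dots> = (g \<cdot> r) \<cdot> w" using D Comp_assoc[of w r g] by simp
  finally show "f \<cdot> (p \<cdot> t) = (g \<cdot> r) \<cdot> w" .
  show "f \<in> Arr C" "g \<cdot> r \<in> Arr C" "p \<cdot> t \<in> Arr C" "w \<in> Arr C" "Cod C f = Cod C (g \<cdot> r)"
    "Dom C (p \<cdot> t) = Dom C w" "Cod C (p \<cdot> t) = Dom C f" "Cod C w = Dom C (g \<cdot> r)"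
    using D by (simp_all add: Comp_Arr Dom_Comp Cod_Comp)
  show "\<exists>h \<in> Arr C. Dom C h = Dom C x \<and> Cod C h = Dom C (p \<cdot> t) \<and> p \<cdot> t \<cdot> h = x \<and> w \<cdot> h = y"
    if x: "x \<in> Arr C" "y \<in> Arr C" "Dom C x = Dom C y" "Cod C x = Dom C f" "Cod C y = Dom C (g \<cdot> r)"
      "f \<cdot> x = (g \<cdot> r) \<cdot> y" for x y
  proof -
    have cy: "Cod C y = Dom C r" using x D by (simp add: Dom_Comp)
    have ry: "r \<cdot> y \<in> Arr C" "Dom C (r \<cdot> y) = Dom C x" "Cod C (r \<cdot> y) = Dom C g"
      using x(2,3) D cy by (simp_all add: Comp_Arr Dom_Comp Cod_Comp)
    have "f \<cdot> x = g \<cdot> (r \<cdot> y)" using x(2,6) D cy Comp_assoc[of y r g] by simp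
    then obtain h where h: "h \<in> Arr C" "Dom C h = Dom C x" "Cod C h = Dom C p" "p \<cdot> h = x" "q \<cdot> h = r \<cdot> y"
      using pullback_lift[OF 1 x(1) ry(1) ry(2)[symmetric] x(4) ry(3)] by blast
    have hq: "Dom C h = Dom C y" "Cod C h = Dom C q" using h(2,3) x(3) D by simp_all
    obtain k where k: "k \<in> Arr C" "Dom C k = Dom C h" "Cod C k = Dom C t" "t \<cdot> k = h" "w \<cdot> k = y"
      using pullback_lift[OF 2 h(1) x(2) hq cy h(5)] by blast
    have "(p \<cdot> t) \<cdot> k = x" using k(1,3,4) h(4) D Comp_assoc[of k t p] by simp
    moreover have "Dom C k = Dom C x" "Cod C k = Dom C (p \<cdot> t)"
      using k(2,3) h(2) D by (simp_all add: Dom_Comp)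
    ultimately show ?thesis using k(1,5) by blast
  qed
  show "h = k" if h: "h \<in> Arr C" "k \<in> Arr C" "Dom C h = Dom C k" "Cod C h = Dom C (p \<cdot> t)"
    "Cod C k = Dom C (p \<cdot> t)" "p \<cdot> t \<cdot> h = p \<cdot> t \<cdot> k" "w \<cdot> h = w \<cdot> k" for h k
  proof -
    have "Dom C (p \<cdot> t) = Dom C t" using D Dom_Comp[of t p] by simp
    then have c: "Cod C h = Dom C t" "Cod C k = Dom C t" using h(4,5) by simp_all
    have a: "p \<cdot> (t \<cdot> h) = p \<cdot> (t \<cdot> k)"
      using h(1,2,6) c D Comp_assoc[of h t p] Comp_assoc[of k t p] by simp
    have "q \<cdot> (t \<cdot> h) = (r \<cdot> w) \<cdot> h" using h(1) c D Comp_assoc[of h t q] by simp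
    also have "\<dots> = (r \<cdot> w) \<cdot> k"
      using h(1,2,7) c D Comp_assoc[of h w r] Comp_assoc[of k w r] by simp
    also have "\<dots> = q \<cdot> (t \<cdot> k)" using h(2) c D Comp_assoc[of k t q] by simp
    finally have b: "q \<cdot> (t \<cdot> h) = q \<cdot> (t \<cdot> k)" .
    have "t \<cdot> h \<in> Arr C" "t \<cdot> k \<in> Arr C" "Dom C (t \<cdot> h) = Dom C (t \<cdot> k)"
      "Cod C (t \<cdot> h) = Dom C p" "Cod C (t \<cdot> k) = Dom C p"
      using h(1-3) c D by (simp_all add: Comp_Arr Dom_Comp Cod_Comp)
    then have "t \<cdot> h = t \<cdot> k" using a b by (rule pullback_unique[OF 1])
    then show ?thesis using pullback_unique[OF 2 h(1,2,3) c] h(7) by simp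
  qed
qed

lemma pullback_iso:
  assumes pb: "is_pullback C p q f g" and i: "is_iso C i" "Cod C i = Dom C p"
  shows "is_pullback C (p \<cdot> i) (q \<cdot> i) f g"
proof (rule pullbackI)
  note D = pullbackD[OF pb]
  obtain j where j: "j \<in> Arr C" "i \<in> Arr C" "Dom C j = Cod C i" "Cod C j = Dom C i"
    "j \<cdot> i = Ide C (Dom C i)" "i \<cdot> j = Ide C (Cod C i)" using i(1) by (rule is_isoE)
  show "f \<cdot> (p \<cdot> i) = g \<cdot> (q \<cdot> i)"
    using D i j Comp_assoc[of i p f] Comp_assoc[of i q g] by simp
  show "\<exists>h \<in> Arr C. Dom C h = Dom C x \<and> Cod C h = Dom C (p \<cdot> i) \<and> p \<cdot> i \<cdot> h = x \<and> q \<cdot> i \<cdot> h = y"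
    if x: "x \<in> Arr C" "y \<in> Arr C" "Dom C x = Dom C y" "Cod C x = Dom C f" "Cod C y = Dom C g"
      "f \<cdot> x = g \<cdot> y" for x y
  proof -
    obtain h where h: "h \<in> Arr C" "Dom C h = Dom C x" "Cod C h = Dom C p" "p \<cdot> h = x" "q \<cdot> h = y"
      using pullback_lift[OF pb x] by blast
    have "i \<cdot> (j \<cdot> h) = h" using h(1,3) j i(2) Comp_assoc[of h j i] Ide_Comp[of h] by simp
    have jh: "j \<cdot> h \<in> Arr C" "Dom C (j \<cdot> h) = Dom C x" "Cod C (j \<cdot> h) = Dom C i"
      using h(1-3) j(1-4) i(2) by (simp_all add: Comp_Arr Dom_Comp Cod_Comp)
    have "p \<cdot> i \<cdot> (j \<cdot> h) = p \<cdot> (i \<cdot> (j \<cdot> h))" "q \<cdot> i \<cdot> (j \<cdot> h) = q \<cdot> (i \<cdot> (j \<cdot> h))"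
      by (rule Comp_assoc; use D jh(1,3) j(2) i(2) in simp)+
    then have "p \<cdot> i \<cdot> (j \<cdot> h) = x" "q \<cdot> i \<cdot> (j \<cdot> h) = y" using \<open>i \<cdot> (j \<cdot> h) = h\<close> h(4,5) by simp_all
    moreover have "Cod C (j \<cdot> h) = Dom C (p \<cdot> i)" using jh(3) Dom_Comp[of i p] D j(2) i(2) by simp
    ultimately show ?thesis using jh(1,2) by blast
  qed
  show "h = k" if h: "h \<in> Arr C" "k \<in> Arr C" "Dom C h = Dom C k" "Cod C h = Dom C (p \<cdot> i)"
    "Cod C k = Dom C (p \<cdot> i)" "p \<cdot> i \<cdot> h = p \<cdot> i \<cdot> k" "q \<cdot> i \<cdot> h = q \<cdot> i \<cdot> k" for h k
  proof -
    have c: "Cod C h = Dom C i" "Cod C k = Dom C i" using h D i j by (simp_all add: Dom_Comp)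
    have e: "p \<cdot> (i \<cdot> h) = p \<cdot> (i \<cdot> k)" "q \<cdot> (i \<cdot> h) = q \<cdot> (i \<cdot> k)"
      using h(1,2,6,7) c D i(2) j(2) Comp_assoc[of h i p] Comp_assoc[of k i p]
        Comp_assoc[of h i q] Comp_assoc[of k i q] by simp_all
    have "i \<cdot> h \<in> Arr C" "i \<cdot> k \<in> Arr C" "Dom C (i \<cdot> h) = Dom C (i \<cdot> k)"
      "Cod C (i \<cdot> h) = Dom C p" "Cod C (i \<cdot> k) = Dom C p"
      using h(1-3) c i(2) j(2) by (simp_all add: Comp_Arr Dom_Comp Cod_Comp)
    then have "i \<cdot> h = i \<cdot> k" using e by (rule pullback_unique[OF pb])
    then have "j \<cdot> (i \<cdot> h) = j \<cdot> (i \<cdot> k)" by simp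
    then show ?thesis
      using iso_cancel_left[OF j(1-5) h(1) c(1)] iso_cancel_left[OF j(1-5) h(2) c(2)] by simp
  qed
qed (use pullbackD[OF pb] i in \<open>auto simp: Comp_Arr Dom_Comp Cod_Comp is_iso_def\<close>)

lemma pullback_Ide:
  assumes "f \<in> Arr C"
  shows "is_pullback C (Ide C (Dom C f)) f f (Ide C (Cod C f))"
proof (rule pullbackI)
  show "\<exists>h \<in> Arr C. Dom C h = Dom C x \<and> Cod C h = Dom C (Ide C (Dom C f)) \<and>
      Ide C (Dom C f) \<cdot> h = x \<and> f \<cdot> h = y"
    if "x \<in> Arr C" "y \<in> Arr C" "Dom C x = Dom C y" "Cod C x = Dom C f"
      "Cod C y = Dom C (Ide C (Cod C f))" "f \<cdot> x = Ide C (Cod C f) \<cdot> y" for x y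
    using that assms Ide_Comp[of x] Ide_Comp[of y] by (intro bexI[of _ x]) (auto simp: cat_simps)
  show "h = k" if "h \<in> Arr C" "k \<in> Arr C" "Dom C h = Dom C k" "Cod C h = Dom C (Ide C (Dom C f))"
    "Cod C k = Dom C (Ide C (Dom C f))" "Ide C (Dom C f) \<cdot> h = Ide C (Dom C f) \<cdot> k" for h k
    using that assms Ide_Comp[of h] Ide_Comp[of k] by (simp add: cat_simps)
qed (use assms in \<open>auto simp: cat_simps\<close>)

end


context subobject_class
begin

lemma S_Arr: "s \<in> S \<Longrightarrow> s \<in> Arr C"
  using S_monic by (auto simp: monic_def)

lemma S_iso: "is_iso C i \<Longrightarrow> i \<in> S"
  by (rule S_split_monic) (auto simp: is_iso_def split_monic_def)

lemma S_Ide: "a \<in> Ob C \<Longrightarrow> Ide C a \<in> S"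
  by (simp add: S_iso is_iso_Ide)

lemma spans_iff: "(\<sigma>, \<phi>) \<in> spans C S \<longleftrightarrow> \<sigma> \<in> S \<and> \<phi> \<in> Arr C \<and> Dom C \<sigma> = Dom C \<phi>"
  using S_Arr by (auto simp: spans_def)

lemma span_iso_iff: "((\<sigma>, \<phi>), (\<sigma>', \<phi>')) \<in> span_iso C S \<longleftrightarrow>
   (\<sigma>, \<phi>) \<in> spans C S \<and> (\<sigma>', \<phi>') \<in> spans C S \<and>
   (\<exists>i. is_iso C i \<and> i \<in> hom C (Dom C \<sigma>) (Dom C \<sigma>') \<and> \<sigma> = \<sigma>' \<cdot> i \<and> \<phi> = \<phi>' \<cdot> i)"
  by (simp add: span_iso_def)

lemma equiv_span_iso: "equiv (spans C S) (span_iso C S)"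
proof (rule equivI)
  show "span_iso C S \<subseteq> spans C S \<times> spans C S" by (auto simp: span_iso_def)
  show "refl_on (spans C S) (span_iso C S)"
  proof (rule refl_onI, clarify)
    fix \<sigma> \<phi> assume s: "(\<sigma>, \<phi>) \<in> spans C S"
    then show "((\<sigma>, \<phi>), (\<sigma>, \<phi>)) \<in> span_iso C S"
      unfolding span_iso_iff using S_Arr Comp_Ide[of \<phi>] Comp_Ide[of \<sigma>]
      by (auto simp: spans_iff Ide_hom Dom_Ob intro!: exI[of _ "Ide C (Dom C \<sigma>)"] is_iso_Ide)
  qed
  show "sym (span_iso C S)"
  proof (rule symI, clarify)
    fix \<sigma> \<phi> \<sigma>' \<phi>' assume a: "((\<sigma>, \<phi>), (\<sigma>', \<phi>')) \<in> span_iso C S"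
    then obtain i where i: "is_iso C i" "i \<in> hom C (Dom C \<sigma>) (Dom C \<sigma>')" "\<sigma> = \<sigma>' \<cdot> i" "\<phi> = \<phi>' \<cdot> i"
      and s: "(\<sigma>, \<phi>) \<in> spans C S" "(\<sigma>', \<phi>') \<in> spans C S" by (auto simp: span_iso_iff)
    obtain j where j: "is_iso C j" "j \<in> Arr C" "i \<in> Arr C" "Dom C j = Cod C i" "Cod C j = Dom C i"
      "j \<cdot> i = Ide C (Dom C i)" "i \<cdot> j = Ide C (Cod C i)" using i(1) by (rule is_isoE)
    have "\<sigma>' = \<sigma> \<cdot> j" "\<phi>' = \<phi> \<cdot> j"
      using iso_cancel[OF j(2-5) j(7)] i s S_Arr by (auto simp: spans_iff hom_def)
    then show "((\<sigma>', \<phi>'), (\<sigma>, \<phi>)) \<in> span_iso C S"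
      unfolding span_iso_iff using s j i(2) by (intro conjI exI[of _ j]) (auto simp: hom_def)
  qed
  show "trans (span_iso C S)"
  proof (rule transI, clarify)
    fix a b a' b' a'' b''
    assume "((a, b), (a', b')) \<in> span_iso C S" "((a', b'), (a'', b'')) \<in> span_iso C S"
    then obtain i j where s: "(a, b) \<in> spans C S" "(a', b') \<in> spans C S" "(a'', b'') \<in> spans C S"
      and i: "is_iso C i" "i \<in> hom C (Dom C a) (Dom C a')" "a = a' \<cdot> i" "b = b' \<cdot> i"
      and j: "is_iso C j" "j \<in> hom C (Dom C a') (Dom C a'')" "a' = a'' \<cdot> j" "b' = b'' \<cdot> j"
      by (auto simp: span_iso_iff)
    have A: "i \<in> Arr C" "j \<in> Arr C" "Dom C i = Dom C a" "Cod C i = Dom C a'" "Dom C j = Dom C a'"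
      "Cod C j = Dom C a''" using i(2) j(2) by (simp_all add: hom_def)
    have B: "a'' \<in> Arr C" "b'' \<in> Arr C" "Dom C a'' = Dom C b''" using s S_Arr by (auto simp: spans_iff)
    have "a = a'' \<cdot> (j \<cdot> i)" "b = b'' \<cdot> (j \<cdot> i)"
      using A B Comp_assoc[of i j a''] Comp_assoc[of i j b'']
      by (simp_all add: i(3,4) j(3,4)[symmetric])
    moreover have "is_iso C (j \<cdot> i)" using i(1) j(1) A by (intro is_iso_Comp) simp_all
    moreover have "j \<cdot> i \<in> hom C (Dom C a) (Dom C a'')" using A Comp_hom[of i j] by simp
    ultimately show "((a, b), (a'', b'')) \<in> span_iso C S" unfolding span_iso_iff using s by blast
  qed
qed

lemma Par_simps:
  "Ob (Par C S) = Ob C" "Arr (Par C S) = spans C S // span_iso C S" "Comp (Par C S) = par_comp C"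
  "Ide (Par C S) a = span_class C S (Ide C a, Ide C a)" "le (Par C S) = par_le C S"
  by (simp_all add: Par_def)

lemma Par_ArrE:
  assumes "F \<in> Arr (Par C S)"
  obtains \<sigma> \<phi> where "(\<sigma>, \<phi>) \<in> spans C S" "F = span_class C S (\<sigma>, \<phi>)"
  using assms by (auto simp: Par_simps span_class_def elim!: quotientE)

lemma span_class_Arr: "s \<in> spans C S \<Longrightarrow> span_class C S s \<in> Arr (Par C S)"
  by (simp add: Par_simps span_class_def quotientI)

lemma span_class_self: "s \<in> spans C S \<Longrightarrow> s \<in> span_class C S s"
  unfolding span_class_def by (rule equiv_class_self[OF equiv_span_iso])

lemma span_class_ends:
  assumes "(\<sigma>, \<phi>) \<in> spans C S" "(\<sigma>', \<phi>') \<in> span_class C S (\<sigma>, \<phi>)"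
  shows "Cod C \<sigma>' = Cod C \<sigma>" "Cod C \<phi>' = Cod C \<phi>"
  using assms S_Arr by (auto simp: span_class_def span_iso_iff spans_iff hom_def Cod_Comp)

lemma Dom_Par:
  assumes "(\<sigma>, \<phi>) \<in> spans C S"
  shows "Dom (Par C S) (span_class C S (\<sigma>, \<phi>)) = Cod C \<sigma>"
proof -
  have "the_elem ((\<lambda>(\<sigma>, \<phi>). Cod C \<sigma>) ` span_class C S (\<sigma>, \<phi>)) = (\<lambda>(\<sigma>, \<phi>). Cod C \<sigma>) (\<sigma>, \<phi>)"
  proof (rule the_elem_image_unique)
    show "span_class C S (\<sigma>, \<phi>) \<noteq> {}" using span_class_self[OF assms] by blast
    show "(\<lambda>(\<sigma>, \<phi>). Cod C \<sigma>) s = (\<lambda>(\<sigma>, \<phi>). Cod C \<sigma>) (\<sigma>, \<phi>)" if "s \<in> span_class C S (\<sigma>, \<phi>)" for s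
      using span_class_ends(1)[OF assms, of "fst s" "snd s"] that by (simp add: case_prod_beta)
  qed
  then show ?thesis by (simp add: Par_def)
qed

lemma Cod_Par:
  assumes "(\<sigma>, \<phi>) \<in> spans C S"
  shows "Cod (Par C S) (span_class C S (\<sigma>, \<phi>)) = Cod C \<phi>"
proof -
  have "the_elem ((\<lambda>(\<sigma>, \<phi>). Cod C \<phi>) ` span_class C S (\<sigma>, \<phi>)) = (\<lambda>(\<sigma>, \<phi>). Cod C \<phi>) (\<sigma>, \<phi>)"
  proof (rule the_elem_image_unique)
    show "span_class C S (\<sigma>, \<phi>) \<noteq> {}" using span_class_self[OF assms] by blast
    show "(\<lambda>(\<sigma>, \<phi>). Cod C \<phi>) s = (\<lambda>(\<sigma>, \<phi>). Cod C \<phi>) (\<sigma>, \<phi>)" if "s \<in> span_class C S (\<sigma>, \<phi>)" for s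
      using span_class_ends(2)[OF assms, of "fst s" "snd s"] that by (simp add: case_prod_beta)
  qed
  then show ?thesis by (simp add: Par_def)
qed

lemma comp_span:
  assumes "(\<sigma>, \<phi>) \<in> spans C S" "(\<tau>, \<psi>) \<in> spans C S" "is_pullback C p q \<phi> \<tau>"
  shows "(\<sigma> \<cdot> p, \<psi> \<cdot> q) \<in> spans C S"
proof -
  note D = pullbackD[OF assms(3)]
  have "p \<in> S" using S_pullback assms by (auto simp: spans_iff)
  then show ?thesis using assms(1,2) D S_Arr S_Comp[of p \<sigma>]
    by (auto simp: spans_iff Comp_Arr Dom_Comp)
qed

lemma Par_Comp_class:
  assumes s: "(\<sigma>, \<phi>) \<in> spans C S" and t: "(\<tau>, \<psi>) \<in> spans C S" and pb: "is_pullback C p q \<phi> \<tau>"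
  shows "par_comp C (span_class C S (\<tau>, \<psi>)) (span_class C S (\<sigma>, \<phi>))
    = span_class C S (\<sigma> \<cdot> p, \<psi> \<cdot> q)"
proof (intro equalityI subrelI)
  note D = pullbackD[OF pb]
  have A: "\<sigma> \<in> Arr C" "\<tau> \<in> Arr C" "\<psi> \<in> Arr C" "Dom C \<sigma> = Dom C \<phi>" "Dom C \<tau> = Dom C \<psi>"
    using s t S_Arr by (auto simp: spans_iff)
  fix a b
  assume "(a, b) \<in> par_comp C (span_class C S (\<tau>, \<psi>)) (span_class C S (\<sigma>, \<phi>))"
  then obtain \<sigma>' \<phi>' \<tau>' \<psi>' p' q' where ab: "a = \<sigma>' \<cdot> p'" "b = \<psi>' \<cdot> q'"
    and s': "((\<sigma>, \<phi>), (\<sigma>', \<phi>')) \<in> span_iso C S" and t': "((\<tau>, \<psi>), (\<tau>', \<psi>')) \<in> span_iso C S"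
    and pb': "is_pullback C p' q' \<phi>' \<tau>'"
    by (auto simp: par_comp_def span_class_def)
  note D' = pullbackD[OF pb']
  obtain i where i0: "is_iso C i" and i: "i \<in> hom C (Dom C \<sigma>) (Dom C \<sigma>')" "\<sigma> = \<sigma>' \<cdot> i" "\<phi> = \<phi>' \<cdot> i"
    and s1: "(\<sigma>', \<phi>') \<in> spans C S" using s' by (auto simp: span_iso_iff)
  obtain j where j0: "is_iso C j" and j: "j \<in> hom C (Dom C \<tau>) (Dom C \<tau>')" "\<tau> = \<tau>' \<cdot> j" "\<psi> = \<psi>' \<cdot> j"
    and t1: "(\<tau>', \<psi>') \<in> spans C S" using t' by (auto simp: span_iso_iff)
  have A': "\<sigma>' \<in> Arr C" "\<psi>' \<in> Arr C" "Dom C \<sigma>' = Dom C \<phi>'" "Dom C \<tau>' = Dom C \<psi>'"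
    using s1 t1 S_Arr by (auto simp: spans_iff)
  have I: "i \<in> Arr C" "Dom C i = Dom C \<phi>" "Cod C i = Dom C \<phi>'"
    and J: "j \<in> Arr C" "Dom C j = Dom C \<tau>" "Cod C j = Dom C \<tau>'"
    using i(1) j(1) A A' by (auto simp: hom_def)
  obtain i' where i': "i' \<in> Arr C" "Dom C i' = Cod C i" "Cod C i' = Dom C i"
    "i' \<cdot> i = Ide C (Dom C i)" "i \<cdot> i' = Ide C (Cod C i)" using i0 by (rule is_isoE)
  obtain j' where j': "j' \<in> Arr C" "Dom C j' = Cod C j" "Cod C j' = Dom C j"
    "j' \<cdot> j = Ide C (Dom C j)" "j \<cdot> j' = Ide C (Cod C j)" using j0 by (rule is_isoE)
  have ci: "i' \<cdot> (i \<cdot> x) = x" if "x \<in> Arr C" "Cod C x = Dom C \<phi>" for x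
    using that I i' Comp_assoc[of x i i'] Ide_Comp[of x] by simp
  have ci2: "i \<cdot> (i' \<cdot> x) = x" if "x \<in> Arr C" "Cod C x = Dom C \<phi>'" for x
    using that I i' Comp_assoc[of x i' i] Ide_Comp[of x] by simp
  have cj: "j' \<cdot> (j \<cdot> x) = x" if "x \<in> Arr C" "Cod C x = Dom C \<tau>" for x
    using that J j' Comp_assoc[of x j j'] Ide_Comp[of x] by simp
  have cj2: "j \<cdot> (j' \<cdot> x) = x" if "x \<in> Arr C" "Cod C x = Dom C \<tau>'" for x
    using that J j' Comp_assoc[of x j' j] Ide_Comp[of x] by simp
  have e1: "\<phi>' \<cdot> (i \<cdot> x) = \<phi> \<cdot> x" if "x \<in> Arr C" "Cod C x = Dom C \<phi>" for x
    using that I D' Comp_assoc[of x i \<phi>'] i(3) by simp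
  have e2: "\<tau>' \<cdot> (j \<cdot> x) = \<tau> \<cdot> x" if "x \<in> Arr C" "Cod C x = Dom C \<tau>" for x
    using that J D' Comp_assoc[of x j \<tau>'] j(2) by simp
  have e3: "\<sigma>' \<cdot> (i \<cdot> x) = \<sigma> \<cdot> x" if "x \<in> Arr C" "Cod C x = Dom C \<phi>" for x
    using that I A' Comp_assoc[of x i \<sigma>'] i(2) by simp
  have e4: "\<psi>' \<cdot> (j \<cdot> x) = \<psi> \<cdot> x" if "x \<in> Arr C" "Cod C x = Dom C \<tau>" for x
    using that J A' Comp_assoc[of x j \<psi>'] j(3) by simp
  have "\<phi>' \<cdot> (i \<cdot> p) = \<tau>' \<cdot> (j \<cdot> q)" using D by (simp add: e1 e2)
  moreover have x: "i \<cdot> p \<in> Arr C" "j \<cdot> q \<in> Arr C" "Dom C (i \<cdot> p) = Dom C p"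
    "Dom C (i \<cdot> p) = Dom C (j \<cdot> q)" "Cod C (i \<cdot> p) = Dom C \<phi>'" "Cod C (j \<cdot> q) = Dom C \<tau>'"
    using D I J by (simp_all add: Comp_Arr Dom_Comp Cod_Comp)
  ultimately obtain k where k: "k \<in> Arr C" "Dom C k = Dom C p" "Cod C k = Dom C p'"
    "p' \<cdot> k = i \<cdot> p" "q' \<cdot> k = j \<cdot> q"
    using pullback_lift[OF pb' x(1,2,4-6)] x(3) by auto
  have y: "i' \<cdot> p' \<in> Arr C" "j' \<cdot> q' \<in> Arr C" "Dom C (i' \<cdot> p') = Dom C p'"
    "Dom C (i' \<cdot> p') = Dom C (j' \<cdot> q')" "Cod C (i' \<cdot> p') = Dom C \<phi>" "Cod C (j' \<cdot> q') = Dom C \<tau>"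
    using D' I J i'(1-3) j'(1-3) by (simp_all add: Comp_Arr Dom_Comp Cod_Comp)
  have "\<phi> \<cdot> (i' \<cdot> p') = \<phi>' \<cdot> p'" using e1[of "i' \<cdot> p'"] y ci2[of p'] D' by simp
  moreover have "\<tau> \<cdot> (j' \<cdot> q') = \<tau>' \<cdot> q'" using e2[of "j' \<cdot> q'"] y cj2[of q'] D' by simp
  ultimately have "\<phi> \<cdot> (i' \<cdot> p') = \<tau> \<cdot> (j' \<cdot> q')" using D' by simp
  then obtain l where l: "l \<in> Arr C" "Dom C l = Dom C p'" "Cod C l = Dom C p"
    "p \<cdot> l = i' \<cdot> p'" "q \<cdot> l = j' \<cdot> q'"
    using pullback_lift[OF pb y(1,2,4-6)] y(3) by auto
  have "l \<cdot> k = Ide C (Dom C p)"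
  proof (rule pullback_unique[OF pb])
    have "p \<cdot> (l \<cdot> k) = (i' \<cdot> p') \<cdot> k" using l k D Comp_assoc[of k l p] by simp
    also have "\<dots> = i' \<cdot> (i \<cdot> p)" using l k D D' i' I Comp_assoc[of k p' i'] by simp
    finally show "p \<cdot> (l \<cdot> k) = p \<cdot> Ide C (Dom C p)" using D Comp_Ide[of p] by (simp add: ci)
    have "q \<cdot> (l \<cdot> k) = (j' \<cdot> q') \<cdot> k" using l k D Comp_assoc[of k l q] by simp
    also have "\<dots> = j' \<cdot> (j \<cdot> q)" using l k D D' j' J Comp_assoc[of k q' j'] by simp
    finally show "q \<cdot> (l \<cdot> k) = q \<cdot> Ide C (Dom C p)" using D Comp_Ide[of q] by (simp add: cj)
  qed (use l k D in \<open>simp_all add: cat_simps\<close>)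
  moreover have "k \<cdot> l = Ide C (Dom C p')"
  proof (rule pullback_unique[OF pb'])
    have "p' \<cdot> (k \<cdot> l) = (i \<cdot> p) \<cdot> l" using l k D' Comp_assoc[of l k p'] by simp
    also have "\<dots> = i \<cdot> (i' \<cdot> p')" using l k D D' i' I Comp_assoc[of l p i] by simp
    finally show "p' \<cdot> (k \<cdot> l) = p' \<cdot> Ide C (Dom C p')" using D' Comp_Ide[of p'] by (simp add: ci2)
    have "q' \<cdot> (k \<cdot> l) = (j \<cdot> q) \<cdot> l" using l k D' Comp_assoc[of l k q'] by simp
    also have "\<dots> = j \<cdot> (j' \<cdot> q')" using l k D D' j' J Comp_assoc[of l q j] by simp
    finally show "q' \<cdot> (k \<cdot> l) = q' \<cdot> Ide C (Dom C p')" using D' Comp_Ide[of q'] by (simp add: cj2)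
  qed (use l k D' in \<open>simp_all add: cat_simps\<close>)
  ultimately have "is_iso C k" using k l by (intro is_isoI[where j = l]) simp_all
  moreover have "\<sigma> \<cdot> p = (\<sigma>' \<cdot> p') \<cdot> k" "\<psi> \<cdot> q = (\<psi>' \<cdot> q') \<cdot> k"
    using k A' D' D e3[of p] e4[of q] Comp_assoc[of k p' \<sigma>'] Comp_assoc[of k q' \<psi>'] by simp_all
  moreover have "k \<in> hom C (Dom C (\<sigma> \<cdot> p)) (Dom C (\<sigma>' \<cdot> p'))"
    using k A A' D D' by (simp add: hom_def Dom_Comp)
  ultimately show "(a, b) \<in> span_class C S (\<sigma> \<cdot> p, \<psi> \<cdot> q)"
    unfolding ab span_class_def Image_singleton_iff span_iso_iff
    using comp_span[OF s t pb] comp_span[OF s1 t1 pb'] by blast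
next
  note D = pullbackD[OF pb]
  have A: "\<sigma> \<in> Arr C" "\<psi> \<in> Arr C" "Dom C \<sigma> = Dom C \<phi>" "Dom C \<tau> = Dom C \<psi>"
    using s t S_Arr by (auto simp: spans_iff)
  fix a b assume "(a, b) \<in> span_class C S (\<sigma> \<cdot> p, \<psi> \<cdot> q)"
  then have "((a, b), (\<sigma> \<cdot> p, \<psi> \<cdot> q)) \<in> span_iso C S"
    using equiv_span_iso by (auto simp: span_class_def equiv_def dest: symD)
  then obtain i where i: "is_iso C i" "i \<in> hom C (Dom C a) (Dom C (\<sigma> \<cdot> p))"
    "a = (\<sigma> \<cdot> p) \<cdot> i" "b = (\<psi> \<cdot> q) \<cdot> i" by (auto simp: span_iso_iff)
  have I: "i \<in> Arr C" "Cod C i = Dom C p" using i(2) A D by (auto simp: hom_def Dom_Comp)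
  have "a = \<sigma> \<cdot> (p \<cdot> i)" "b = \<psi> \<cdot> (q \<cdot> i)" using i I A D by (simp_all add: Comp_assoc)
  moreover have "is_pullback C (p \<cdot> i) (q \<cdot> i) \<phi> \<tau>" using pb i(1) I(2) by (rule pullback_iso)
  ultimately show "(a, b) \<in> par_comp C (span_class C S (\<tau>, \<psi>)) (span_class C S (\<sigma>, \<phi>))"
    unfolding par_comp_def using span_class_self[OF s] span_class_self[OF t] by blast
qed

theorem category_Par: "category (Par C S)"
proof
  have idsp: "(Ide C a, Ide C a) \<in> spans C S" if "a \<in> Ob C" for a
    using that by (simp add: spans_iff S_Ide Ide_Arr)
  have pbx: "\<exists>p q. is_pullback C p q \<phi> \<tau>"
    if "(\<sigma>, \<phi>) \<in> spans C S" "(\<tau>, \<psi>) \<in> spans C S" "Cod C \<phi> = Cod C \<tau>" for \<sigma> \<phi> \<tau> \<psi>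
    using that ex_pullback by (auto simp: spans_iff)
  show "Dom (Par C S) F \<in> Ob (Par C S)" if F0: "F \<in> Arr (Par C S)" for F
  proof -
    obtain \<sigma> \<phi> where F: "(\<sigma>, \<phi>) \<in> spans C S" "F = span_class C S (\<sigma>, \<phi>)" using F0 by (rule Par_ArrE)
    then show ?thesis using Dom_Par S_Arr by (simp add: Par_simps(1) spans_iff Cod_Ob)
  qed
  show "Cod (Par C S) F \<in> Ob (Par C S)" if F0: "F \<in> Arr (Par C S)" for F
  proof -
    obtain \<sigma> \<phi> where F: "(\<sigma>, \<phi>) \<in> spans C S" "F = span_class C S (\<sigma>, \<phi>)" using F0 by (rule Par_ArrE)
    then show ?thesis using Cod_Par by (simp add: Par_simps(1) spans_iff Cod_Ob)
  qed
  show "Ide (Par C S) a \<in> hom (Par C S) a a" if "a \<in> Ob (Par C S)" for a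
    using that idsp[of a] span_class_Arr[of "(Ide C a, Ide C a)"] Dom_Par[of "Ide C a" "Ide C a"]
      Cod_Par[of "Ide C a" "Ide C a"]
    by (simp add: hom_def Par_simps(1,4) Cod_Ide)
  show "Comp (Par C S) G F \<in> hom (Par C S) (Dom (Par C S) F) (Cod (Par C S) G)"
    if FG: "F \<in> Arr (Par C S)" "G \<in> Arr (Par C S)" "Dom (Par C S) G = Cod (Par C S) F" for F G
  proof -
    obtain \<sigma> \<phi> where F: "(\<sigma>, \<phi>) \<in> spans C S" "F = span_class C S (\<sigma>, \<phi>)" using FG(1) by (rule Par_ArrE)
    obtain \<tau> \<psi> where G: "(\<tau>, \<psi>) \<in> spans C S" "G = span_class C S (\<tau>, \<psi>)" using FG(2) by (rule Par_ArrE)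
    have "Cod C \<phi> = Cod C \<tau>" using FG(3) F G by (simp add: Dom_Par Cod_Par)
    then obtain p q where pb: "is_pullback C p q \<phi> \<tau>" using pbx F G by blast
    have "\<sigma> \<in> Arr C" "\<psi> \<in> Arr C" "Dom C \<sigma> = Dom C \<phi>" "Dom C \<tau> = Dom C \<psi>"
      using F G S_Arr by (auto simp: spans_iff)
    then show ?thesis
      using Par_Comp_class[OF F(1) G(1) pb] comp_span[OF F(1) G(1) pb] F G pullbackD[OF pb]
      by (simp add: hom_def Par_simps(3) span_class_Arr Dom_Par Cod_Par Cod_Comp)
  qed
  show "Comp (Par C S) F (Ide (Par C S) (Dom (Par C S) F)) = F" if F0: "F \<in> Arr (Par C S)" for F
  proof -
    obtain \<sigma> \<phi> where F: "(\<sigma>, \<phi>) \<in> spans C S" "F = span_class C S (\<sigma>, \<phi>)" using F0 by (rule Par_ArrE)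
    have A: "\<sigma> \<in> Arr C" "\<phi> \<in> Arr C" "Dom C \<phi> = Dom C \<sigma>" using F S_Arr by (auto simp: spans_iff)
    have pb: "is_pullback C \<sigma> (Ide C (Dom C \<sigma>)) (Ide C (Cod C \<sigma>)) \<sigma>"
      using pullback_sym[OF pullback_Ide] A by blast
    show ?thesis
      using Par_Comp_class[OF idsp F(1) pb] F A Comp_Ide[of \<phi>]
      by (simp add: Par_simps(3,4) Dom_Par Cod_Ob Ide_Comp)
  qed
  show "Comp (Par C S) (Ide (Par C S) (Cod (Par C S) F)) F = F" if F0: "F \<in> Arr (Par C S)" for F
  proof -
    obtain \<sigma> \<phi> where F: "(\<sigma>, \<phi>) \<in> spans C S" "F = span_class C S (\<sigma>, \<phi>)" using F0 by (rule Par_ArrE)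
    have A: "\<sigma> \<in> Arr C" "\<phi> \<in> Arr C" "Dom C \<phi> = Dom C \<sigma>" using F S_Arr by (auto simp: spans_iff)
    show ?thesis
      using Par_Comp_class[OF F(1) idsp pullback_Ide] F A Comp_Ide[of \<sigma>]
      by (simp add: Par_simps(3,4) Cod_Par Cod_Ob Ide_Comp)
  qed
  show "Comp (Par C S) (Comp (Par C S) H G) F = Comp (Par C S) H (Comp (Par C S) G F)"
    if FG: "F \<in> Arr (Par C S)" "G \<in> Arr (Par C S)" "H \<in> Arr (Par C S)"
      "Dom (Par C S) G = Cod (Par C S) F" "Dom (Par C S) H = Cod (Par C S) G" for F G H
  proof -
    obtain \<sigma> \<phi> where F: "(\<sigma>, \<phi>) \<in> spans C S" "F = span_class C S (\<sigma>, \<phi>)" using FG(1) by (rule Par_ArrE)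
    obtain \<tau> \<psi> where G: "(\<tau>, \<psi>) \<in> spans C S" "G = span_class C S (\<tau>, \<psi>)" using FG(2) by (rule Par_ArrE)
    obtain \<rho> \<chi> where H: "(\<rho>, \<chi>) \<in> spans C S" "H = span_class C S (\<rho>, \<chi>)" using FG(3) by (rule Par_ArrE)
    have "Cod C \<phi> = Cod C \<tau>" "Cod C \<psi> = Cod C \<rho>" using FG F G H by (simp_all add: Dom_Par Cod_Par)
    then obtain p q r s where 1: "is_pullback C p q \<phi> \<tau>" and 2: "is_pullback C r s \<psi> \<rho>"
      using pbx F G H by metis
    note D1 = pullbackD[OF 1] and D2 = pullbackD[OF 2]
    have A: "\<sigma> \<in> Arr C" "\<chi> \<in> Arr C" "Dom C \<sigma> = Dom C \<phi>" "Dom C \<tau> = Dom C \<psi>" "Dom C \<rho> = Dom C \<chi>"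
      using F G H S_Arr by (auto simp: spans_iff)
    have "r \<in> S" using 2 H S_pullback by (auto simp: spans_iff)
    then obtain t w where 3: "is_pullback C t w q r" using ex_pullback[of r q] D1 D2 A by auto
    note D3 = pullbackD[OF 3]
    have 4: "is_pullback C (p \<cdot> t) w \<phi> (\<tau> \<cdot> r)" using 1 3 by (rule pullback_paste)
    have 5: "is_pullback C t (s \<cdot> w) (\<psi> \<cdot> q) \<rho>"
      by (rule pullback_sym) (rule pullback_paste[OF 2[THEN pullback_sym] 3[THEN pullback_sym]])
    have "par_comp C (par_comp C H G) F = span_class C S (\<sigma> \<cdot> (p \<cdot> t), (\<chi> \<cdot> s) \<cdot> w)"
      using F G H Par_Comp_class[OF G(1) H(1) 2] Par_Comp_class[OF F(1) comp_span[OF G(1) H(1) 2] 4]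
      by simp
    moreover have "par_comp C H (par_comp C G F) = span_class C S ((\<sigma> \<cdot> p) \<cdot> t, \<chi> \<cdot> (s \<cdot> w))"
      using F G H Par_Comp_class[OF F(1) G(1) 1] Par_Comp_class[OF comp_span[OF F(1) G(1) 1] H(1) 5]
      by simp
    ultimately show ?thesis
      using A D1 D2 D3 Comp_assoc[of t p \<sigma>] Comp_assoc[of w s \<chi>] by (simp add: Par_simps(3))
  qed
qed

theorem bij_betw_of_arr: "bij_betw (of_arr C S) (Arr C) {F \<in> Arr (Par C S). total_par C F}"
proof (rule bij_betw_imageI)
  have sp: "(Ide C (Dom C m), m) \<in> spans C S" if "m \<in> Arr C" for m
    using that by (simp add: spans_iff S_Ide Dom_Ob Dom_Ide)
  show "inj_on (of_arr C S) (Arr C)"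
  proof (rule inj_onI)
    fix m n assume m: "m \<in> Arr C" and n: "n \<in> Arr C" and e: "of_arr C S m = of_arr C S n"
    have "((Ide C (Dom C m), m), (Ide C (Dom C n), n)) \<in> span_iso C S"
      using e eq_equiv_class[OF _ equiv_span_iso sp[OF n]] by (simp add: of_arr_def span_class_def)
    then obtain i where i: "i \<in> hom C (Dom C m) (Dom C n)" "Ide C (Dom C m) = Ide C (Dom C n) \<cdot> i" "m = n \<cdot> i"
      using m n by (auto simp: span_iso_iff Dom_Ide Dom_Ob)
    then have "Ide C (Dom C n) \<cdot> i = i" using Ide_Comp[of i] by (simp add: hom_def)
    with i(2) have ii: "i = Ide C (Dom C m)" by simp
    have "Dom C m = Dom C n" using i(1) Cod_Ide[OF Dom_Ob[OF m]] unfolding ii by (simp add: hom_def)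
    then show "m = n" using i(3) ii Comp_Ide[OF n] by metis
  qed
  show "of_arr C S ` Arr C = {F \<in> Arr (Par C S). total_par C F}"
  proof (intro equalityI subsetI)
    fix F assume "F \<in> of_arr C S ` Arr C"
    then obtain m where "m \<in> Arr C" "F = span_class C S (Ide C (Dom C m), m)" by (auto simp: of_arr_def)
    then show "F \<in> {F \<in> Arr (Par C S). total_par C F}"
      using sp[of m] span_class_Arr span_class_self is_iso_Ide[of "Dom C m"]
      by (auto simp: total_par_def Dom_Ob intro!: bexI[of _ "(Ide C (Dom C m), m)"])
  next
    fix F assume "F \<in> {F \<in> Arr (Par C S). total_par C F}"
    then obtain \<sigma> \<phi> where F: "F \<in> spans C S // span_iso C S" "(\<sigma>, \<phi>) \<in> F" "is_iso C \<sigma>"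
      by (auto simp: total_par_def Par_simps)
    have s: "(\<sigma>, \<phi>) \<in> spans C S" and FE: "F = span_class C S (\<sigma>, \<phi>)"
      using F in_quotient_imp_subset[OF equiv_span_iso F(1)] quotient_eqI[OF equiv_span_iso F(1), of "span_class C S (\<sigma>, \<phi>)" "(\<sigma>, \<phi>)" "(\<sigma>, \<phi>)"]
        span_class_self[of "(\<sigma>, \<phi>)"] equiv_span_iso
      by (auto simp: span_class_def quotientI equiv_def refl_on_def)
    obtain j where j: "j \<in> Arr C" "\<sigma> \<in> Arr C" "Dom C j = Cod C \<sigma>" "Cod C j = Dom C \<sigma>"
      "j \<cdot> \<sigma> = Ide C (Dom C \<sigma>)" "\<sigma> \<cdot> j = Ide C (Cod C \<sigma>)" using F(3) by (rule is_isoE)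
    have A: "\<phi> \<in> Arr C" "Dom C \<phi> = Dom C \<sigma>" using s by (auto simp: spans_iff)
    define m where "m = \<phi> \<cdot> j"
    have m: "m \<in> Arr C" "Dom C m = Cod C \<sigma>" using A j by (auto simp: m_def Comp_Arr Dom_Comp)
    have "m \<cdot> \<sigma> = \<phi>" using A j Comp_assoc[of \<sigma> j \<phi>] Comp_Ide[of \<phi>] by (simp add: m_def)
    then have "((\<sigma>, \<phi>), (Ide C (Dom C m), m)) \<in> span_iso C S"
      unfolding span_iso_iff using s sp[OF m(1)] F(3) m j
      by (intro conjI exI[of _ \<sigma>]) (auto simp: hom_def Ide_Comp Dom_Ide Cod_Ob)
    then have "F = of_arr C S m"
      unfolding FE of_arr_def span_class_def by (rule equiv_class_eq[OF equiv_span_iso])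
    then show "F \<in> of_arr C S ` Arr C" using m by blast
  qed
qed

end

end

theory Submission
  imports Defs
begin

text \<open>
  Call \<open>g\<close> an oplax retract of \<open>r\<close> when \<open>g \<preceq> r a\<close>, \<open>r \<preceq> g b\<close> and \<open>b a \<preceq> 1\<close>; the right class of an
  oplax weak factorisation system is closed under these, and dually for the left class. If a total
  map factors as \<open>r l\<close>, then \<open>l\<close> is total and factors through the domain \<open>\<sigma>\<close> of \<open>r = (\<sigma>, \<phi>)\<close>, say
  \<open>l = \<sigma> l'\<close>, and the given map is \<open>\<phi> l'\<close>. The pair \<open>\<sigma>\<close>, \<open>(\<sigma>, 1)\<close> exhibits \<open>\<phi>\<close> as an oplax retract of \<open>r\<close>
  and \<open>l'\<close> as one of \<open>l\<close>, which gives factorisations in \<open>C\<close>. Fillers of squares of total maps are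
  total because total maps are maximal for \<open>\<preceq>\<close>. The remaining inclusions are the usual retract
  argument, as ordinary retracts are oplax retracts.
\<close>

section \<open>Oplax retracts in categories with preordered hom-sets\<close>

text \<open>This isolates what the retract arguments use about partial maps: composition is monotone
  in both arguments. Arrows are compared only inside a common hom-set.\<close>

locale ordered_category = category P
  for P :: "('o, 'm, 'x) ord_cat_scheme" (structure) +
  assumes le_refl: "f \<in> Arr P \<Longrightarrow> f \<preceq> f"
    and le_trans: "f \<in> hom P a b \<Longrightarrow> g \<in> hom P a b \<Longrightarrow> h \<in> hom P a b \<Longrightarrow> f \<preceq> g \<Longrightarrow> g \<preceq> h \<Longrightarrow> f \<preceq> h"
    and Comp_mono_right: "f \<in> hom P a b \<Longrightarrow> g \<in> hom P a b \<Longrightarrow> h \<in> hom P b c \<Longrightarrow> f \<preceq> g \<Longrightarrow> h \<cdot> f \<preceq> h \<cdot> g"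
    and Comp_mono_left: "f \<in> hom P b c \<Longrightarrow> g \<in> hom P b c \<Longrightarrow> h \<in> hom P a b \<Longrightarrow> f \<preceq> g \<Longrightarrow> f \<cdot> h \<preceq> g \<cdot> h"
begin

lemma Comp_in_hom: "f \<in> hom P a b \<Longrightarrow> g \<in> hom P b c \<Longrightarrow> g \<cdot> f \<in> hom P a c"
  using Comp_hom[of f g] by (simp add: hom_def)

lemma hom_assoc:
  "f \<in> hom P a b \<Longrightarrow> g \<in> hom P b c \<Longrightarrow> h \<in> hom P c d \<Longrightarrow> (h \<cdot> g) \<cdot> f = h \<cdot> (g \<cdot> f)"
  using Comp_assoc[of f g h] by (simp add: hom_def)

text \<open>A square \<open>(u, v)\<close> from \<open>f\<close> to \<open>g\<close> is moved along
  \<open>a\<close> to the square \<open>(a u, v)\<close> from \<open>f\<close> to \<open>r\<close>.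
  If \<open>k\<close> fills the latter, then \<open>b k\<close> fills the former:
  \<open>b k f\<close> lies below \<open>b a u\<close>, hence below \<open>u\<close>, and
  \<open>v\<close> lies below \<open>r k\<close>, hence below \<open>g b k\<close>.\<close>

lemma oplax_orth_right_retract:
  assumes orth: "oplax_orth P f r"
    and f: "f \<in> hom P x y" and r: "r \<in> hom P c d" and g: "g \<in> hom P c' d"
    and a: "a \<in> hom P c' c" and b: "b \<in> hom P c c'"
    and ga: "g \<preceq> r \<cdot> a" and rb: "r \<preceq> g \<cdot> b" and ba: "b \<cdot> a \<preceq> Ide P c'"
  shows "oplax_orth P f g"
  unfolding oplax_orth_def
proof (intro allI impI)
  fix u v assume "oplax_square P f g u v"
  then have u: "u \<in> hom P x c'" and v: "v \<in> hom P y d" and uv: "v \<cdot> f \<preceq> g \<cdot> u"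
    using f g by (auto simp: oplax_square_def hom_def)
  have "g \<cdot> u \<preceq> (r \<cdot> a) \<cdot> u"
    by (rule Comp_mono_left[OF g Comp_in_hom[OF a r] u ga])
  then have "v \<cdot> f \<preceq> r \<cdot> (a \<cdot> u)"
    using le_trans[OF Comp_in_hom[OF f v] Comp_in_hom[OF u g] Comp_in_hom[OF Comp_in_hom[OF u a] r] uv]
    by (simp add: hom_assoc[OF u a r])
  then have "oplax_square P f r (a \<cdot> u) v"
    using Comp_in_hom[OF u a] f r v by (auto simp: oplax_square_def hom_def)
  then obtain k where k: "k \<in> hom P y c" and ku: "k \<cdot> f \<preceq> a \<cdot> u" and kv: "v \<preceq> r \<cdot> k"
    using orth f r by (auto simp: oplax_orth_def hom_def)
  have "c' \<in> Ob P" using a Dom_Ob by (auto simp: hom_def)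
  note I = Ide_hom[OF this]
  have "(b \<cdot> a) \<cdot> u \<preceq> Ide P c' \<cdot> u"
    by (rule Comp_mono_left[OF Comp_in_hom[OF a b] I u ba])
  moreover have "Ide P c' \<cdot> u = u" using u Ide_Comp[of u] by (auto simp: hom_def)
  ultimately have "b \<cdot> (a \<cdot> u) \<preceq> u" using hom_assoc[OF u a b] by simp
  moreover have "b \<cdot> (k \<cdot> f) \<preceq> b \<cdot> (a \<cdot> u)"
    by (rule Comp_mono_right[OF Comp_in_hom[OF f k] Comp_in_hom[OF u a] b ku])
  ultimately have "(b \<cdot> k) \<cdot> f \<preceq> u"
    using le_trans[OF Comp_in_hom[OF Comp_in_hom[OF f k] b] Comp_in_hom[OF Comp_in_hom[OF u a] b] u]
    by (simp add: hom_assoc[OF f k b])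
  moreover have "r \<cdot> k \<preceq> (g \<cdot> b) \<cdot> k"
    by (rule Comp_mono_left[OF r Comp_in_hom[OF b g] k rb])
  then have "v \<preceq> g \<cdot> (b \<cdot> k)"
    using le_trans[OF v Comp_in_hom[OF k r] Comp_in_hom[OF Comp_in_hom[OF k b] g] kv]
    by (simp add: hom_assoc[OF k b g])
  ultimately show "\<exists>k \<in> hom P (Cod P f) (Dom P g). k \<cdot> f \<preceq> u \<and> v \<preceq> g \<cdot> k"
    using Comp_in_hom[OF k b] f g by (auto simp: hom_def)
qed

text \<open>Here the lower side of the square is changed: \<open>(u, v a)\<close> is a square from
  \<open>l\<close> to \<open>g\<close>, and a filler \<open>k\<close> of it yields the filler
  \<open>k b\<close>. The inequality \<open>b f \<preceq> l\<close> gives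
  \<open>k b f \<preceq> u\<close>, and the inequality between the identity and \<open>a b\<close>
  gives \<open>v \<preceq> g k b\<close>.\<close>

lemma oplax_orth_left_retract:
  assumes orth: "oplax_orth P l g"
    and l: "l \<in> hom P x y" and f: "f \<in> hom P x y'" and g: "g \<in> hom P c d"
    and a: "a \<in> hom P y y'" and b: "b \<in> hom P y' y"
    and al: "a \<cdot> l \<preceq> f" and bf: "b \<cdot> f \<preceq> l" and ab: "Ide P y' \<preceq> a \<cdot> b"
  shows "oplax_orth P f g"
  unfolding oplax_orth_def
proof (intro allI impI)
  fix u v assume "oplax_square P f g u v"
  then have u: "u \<in> hom P x c" and v: "v \<in> hom P y' d" and uv: "v \<cdot> f \<preceq> g \<cdot> u"
    using f g by (auto simp: oplax_square_def hom_def)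
  have "v \<cdot> (a \<cdot> l) \<preceq> v \<cdot> f"
    by (rule Comp_mono_right[OF Comp_in_hom[OF l a] f v al])
  then have "(v \<cdot> a) \<cdot> l \<preceq> g \<cdot> u"
    using le_trans[OF Comp_in_hom[OF Comp_in_hom[OF l a] v] Comp_in_hom[OF f v] Comp_in_hom[OF u g]] uv
    by (simp add: hom_assoc[OF l a v])
  then have "oplax_square P l g u (v \<cdot> a)"
    using Comp_in_hom[OF a v] l g u by (auto simp: oplax_square_def hom_def)
  then obtain k where k: "k \<in> hom P y c" and ku: "k \<cdot> l \<preceq> u" and kv: "v \<cdot> a \<preceq> g \<cdot> k"
    using orth l g by (auto simp: oplax_orth_def hom_def)
  have "k \<cdot> (b \<cdot> f) \<preceq> k \<cdot> l"
    by (rule Comp_mono_right[OF Comp_in_hom[OF f b] l k bf])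
  then have "(k \<cdot> b) \<cdot> f \<preceq> u"
    using le_trans[OF Comp_in_hom[OF Comp_in_hom[OF f b] k] Comp_in_hom[OF l k] u] ku
    by (simp add: hom_assoc[OF f b k])
  moreover have "y' \<in> Ob P" using a Cod_Ob by (auto simp: hom_def)
  note I = Ide_hom[OF this]
  have "v \<cdot> Ide P y' \<preceq> v \<cdot> (a \<cdot> b)"
    by (rule Comp_mono_right[OF I Comp_in_hom[OF b a] v ab])
  moreover have "v \<cdot> Ide P y' = v" using v Comp_Ide[of v] by (auto simp: hom_def)
  moreover have "(v \<cdot> a) \<cdot> b \<preceq> (g \<cdot> k) \<cdot> b"
    by (rule Comp_mono_left[OF Comp_in_hom[OF a v] Comp_in_hom[OF k g] b kv])
  ultimately have "(k \<cdot> b) \<cdot> f \<preceq> u" "v \<preceq> g \<cdot> (k \<cdot> b)"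
    using le_trans[OF v Comp_in_hom[OF Comp_in_hom[OF b a] v] Comp_in_hom[OF Comp_in_hom[OF b k] g]]
    by (simp_all add: hom_assoc[OF b a v] hom_assoc[OF b k g])
  then show "\<exists>k \<in> hom P (Cod P f) (Dom P g). k \<cdot> f \<preceq> u \<and> v \<preceq> g \<cdot> k"
    using Comp_in_hom[OF b k] f g by (auto simp: hom_def)
qed

lemma oplax_weak_fact_systemD:
  assumes "oplax_weak_fact_system P L R"
  shows "f \<in> L \<Longrightarrow> f \<in> Arr P" "g \<in> R \<Longrightarrow> g \<in> Arr P" "f \<in> L \<Longrightarrow> g \<in> R \<Longrightarrow> oplax_orth P f g"
    "g \<in> Arr P \<Longrightarrow> (\<And>f. f \<in> L \<Longrightarrow> oplax_orth P f g) \<Longrightarrow> g \<in> R"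
    "f \<in> Arr P \<Longrightarrow> (\<And>g. g \<in> R \<Longrightarrow> oplax_orth P f g) \<Longrightarrow> f \<in> L"
    "h \<in> Arr P \<Longrightarrow> \<exists>l \<in> L. \<exists>r \<in> R. Dom P r = Cod P l \<and> h = r \<cdot> l"
  using assms unfolding oplax_weak_fact_system_def by blast+

text \<open>With equations in place of inequalities, reflexivity supplies the data of an oplax
  retract. This form serves both the passage from \<open>r\<close> to its underlying total map
  \<open>\<phi>\<close> and the ordinary retract argument.\<close>

lemma oplax_right_class_retract:
  assumes "oplax_weak_fact_system P L R" "r \<in> R" "r \<in> hom P c d" "g \<in> hom P c' d"
    "a \<in> hom P c' c" "b \<in> hom P c c'" "g = r \<cdot> a" "r = g \<cdot> b" "b \<cdot> a = Ide P c'"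
  shows "g \<in> R"
proof -
  have "c' \<in> Ob P" using assms(5) Dom_Ob by (auto simp: hom_def)
  then have le: "g \<preceq> r \<cdot> a" "r \<preceq> g \<cdot> b" "b \<cdot> a \<preceq> Ide P c'"
    using assms(3,4) le_refl Ide_Arr
    \<comment> \<open>The two equations define \<open>g\<close> through \<open>r\<close> and
      \<open>r\<close> through \<open>g\<close>, so rewriting with them from left to right would not
      end; they are folded instead.\<close>
    unfolding assms(7)[symmetric] assms(8)[symmetric] assms(9) by (auto simp: hom_def)
  have "oplax_orth P f g" if "f \<in> L" for f
  proof (rule oplax_orth_right_retract[OF _ _ assms(3-6) le])
    show "oplax_orth P f r" using oplax_weak_fact_systemD(3)[OF assms(1)] assms(2) that by blast
    show "f \<in> hom P (Dom P f) (Cod P f)"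
      using oplax_weak_fact_systemD(1,2)[OF assms(1)] that by (auto simp: hom_def)
  qed
  then show ?thesis using oplax_weak_fact_systemD(4)[OF assms(1)] assms(4) by (auto simp: hom_def)
qed

lemma oplax_left_class_retract:
  assumes "oplax_weak_fact_system P L R" "l \<in> L" "l \<in> hom P x y" "f \<in> hom P x y'"
    "a \<in> hom P y y'" "b \<in> hom P y' y" "a \<cdot> l = f" "b \<cdot> f = l" "a \<cdot> b = Ide P y'"
  shows "f \<in> L"
proof -
  have "y' \<in> Ob P" using assms(5) Cod_Ob by (auto simp: hom_def)
  then have le: "a \<cdot> l \<preceq> f" "b \<cdot> f \<preceq> l" "Ide P y' \<preceq> a \<cdot> b"
    using assms(3,4,7-9) le_refl Ide_Arr by (auto simp: hom_def)
  have "oplax_orth P f g" if "g \<in> R" for g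
  proof (rule oplax_orth_left_retract[OF _ assms(3,4) _ assms(5,6) le])
    show "oplax_orth P l g" using oplax_weak_fact_systemD(3)[OF assms(1)] assms(2) that by blast
    show "g \<in> hom P (Dom P g) (Cod P g)"
      using oplax_weak_fact_systemD(1,2)[OF assms(1)] that by (auto simp: hom_def)
  qed
  then show ?thesis using oplax_weak_fact_systemD(5)[OF assms(1)] assms(4) by (auto simp: hom_def)
qed

end

section \<open>The order on partial maps and its compatibility with composition\<close>

context subobject_class
begin

text \<open>Since \<open>\<tau>\<close> is monic, \<open>h\<close> is the pullback of
  \<open>\<tau> \<cdot> h\<close> along \<open>\<tau>\<close>, with an identity as the opposite leg;
  stability of \<open>S\<close> under pullback then applies.\<close>

lemma S_cancel:
  assumes "\<tau> \<in> S" "\<tau> \<cdot> h \<in> S" "h \<in> Arr C" "Cod C h = Dom C \<tau>"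
  shows "h \<in> S"
proof -
  note A = S_Arr[OF assms(1)]
  have "is_pullback C h (Ide C (Dom C h)) \<tau> (\<tau> \<cdot> h)"
  proof (rule pullbackI)
    show "\<exists>k \<in> Arr C. Dom C k = Dom C x \<and> Cod C k = Dom C h \<and> h \<cdot> k = x \<and> Ide C (Dom C h) \<cdot> k = y"
      if x: "x \<in> Arr C" "y \<in> Arr C" "Dom C x = Dom C y" "Cod C x = Dom C \<tau>"
        "Cod C y = Dom C (\<tau> \<cdot> h)" "\<tau> \<cdot> x = \<tau> \<cdot> h \<cdot> y" for x y
    proof -
      have y: "Cod C y = Dom C h" using x A assms by (simp add: Dom_Comp)
      then have "\<tau> \<cdot> x = \<tau> \<cdot> (h \<cdot> y)" using x A assms by (simp add: Comp_assoc)
      moreover have "h \<cdot> y \<in> hom C (Dom C x) (Dom C \<tau>)" "x \<in> hom C (Dom C x) (Dom C \<tau>)"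
        using x y assms by (auto simp: hom_def cat_simps)
      ultimately have "h \<cdot> y = x" using S_monic[OF assms(1)] unfolding monic_def by metis
      then show ?thesis using x y Ide_Comp[of y] by auto
    qed
    show "k = m" if "k \<in> Arr C" "m \<in> Arr C" "Cod C k = Dom C h" "Cod C m = Dom C h"
      "Ide C (Dom C h) \<cdot> k = Ide C (Dom C h) \<cdot> m" for k m
      using that Ide_Comp[of k] Ide_Comp[of m] by simp
    show "\<tau> \<cdot> h = (\<tau> \<cdot> h) \<cdot> Ide C (Dom C h)"
      using A assms Comp_Ide[of "\<tau> \<cdot> h"] by (simp add: Comp_Arr Dom_Comp)
  qed (use A assms in \<open>simp_all add: cat_simps\<close>)
  then show ?thesis using S_pullback assms(2) by blast
qed

lemma span_class_iff:
  assumes "s \<in> spans C S" "t \<in> spans C S"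
  shows "span_class C S s = span_class C S t \<longleftrightarrow> (s, t) \<in> span_iso C S"
  using eq_equiv_class_iff[OF equiv_span_iso assms] by (simp add: span_class_def)

text \<open>The order can be tested on any chosen representatives, because isomorphisms of spans can
  be absorbed into the comparison arrow. That this arrow lies in \<open>S\<close> follows from
  \<open>S_cancel\<close>, so any factorisation of spans will do.\<close>

lemma par_le_class_iff:
  assumes s: "(\<sigma>, \<phi>) \<in> spans C S" and t: "(\<tau>, \<psi>) \<in> spans C S"
  shows "par_le C S (span_class C S (\<sigma>, \<phi>)) (span_class C S (\<tau>, \<psi>)) \<longleftrightarrow>
    (\<exists>h \<in> hom C (Dom C \<sigma>) (Dom C \<tau>). \<sigma> = \<tau> \<cdot> h \<and> \<phi> = \<psi> \<cdot> h)"
proof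
  assume "par_le C S (span_class C S (\<sigma>, \<phi>)) (span_class C S (\<tau>, \<psi>))"
  then obtain \<sigma>' \<phi>' \<tau>' \<psi>' h where s': "((\<sigma>, \<phi>), (\<sigma>', \<phi>')) \<in> span_iso C S"
    and t': "((\<tau>, \<psi>), (\<tau>', \<psi>')) \<in> span_iso C S"
    and h: "h \<in> hom C (Dom C \<sigma>') (Dom C \<tau>')" "\<sigma>' = \<tau>' \<cdot> h" "\<phi>' = \<psi>' \<cdot> h"
    unfolding par_le_def span_class_def by blast
  \<comment> \<open>Reversing this isomorphism gives an arrow \<open>j\<close> out of the domain of
    \<open>\<tau>'\<close>, so that \<open>j \<cdot> (h \<cdot> i)\<close> compares the chosen
    representatives.\<close>
  have "((\<tau>', \<psi>'), (\<tau>, \<psi>)) \<in> span_iso C S"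
    using t' equiv_span_iso by (meson equiv_def symD)
  then obtain j where j: "j \<in> hom C (Dom C \<tau>') (Dom C \<tau>)" "\<tau>' = \<tau> \<cdot> j" "\<psi>' = \<psi> \<cdot> j"
    by (auto simp: span_iso_iff)
  obtain i where i: "i \<in> hom C (Dom C \<sigma>) (Dom C \<sigma>')" "\<sigma> = \<sigma>' \<cdot> i" "\<phi> = \<phi>' \<cdot> i"
    using s' by (auto simp: span_iso_iff)
  have A: "\<tau> \<in> Arr C" "\<psi> \<in> Arr C" "Dom C \<tau> = Dom C \<psi>" using t S_Arr by (auto simp: spans_iff)
  have T: "i \<in> Arr C" "h \<in> Arr C" "j \<in> Arr C" "Cod C i = Dom C h" "Cod C h = Dom C j"
    "Cod C j = Dom C \<tau>" "Dom C i = Dom C \<sigma>"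
    using i(1) h(1) j(1) by (auto simp: hom_def)
  have "x \<cdot> j \<cdot> h \<cdot> i = x \<cdot> (j \<cdot> (h \<cdot> i))" if "x \<in> Arr C" "Dom C x = Dom C \<tau>" for x
    using T that by (simp add: cat_simps)
  then have "\<sigma> = \<tau> \<cdot> (j \<cdot> (h \<cdot> i))" "\<phi> = \<psi> \<cdot> (j \<cdot> (h \<cdot> i))"
    using A i(2,3) h(2,3) j(2,3) by simp_all
  moreover have "j \<cdot> (h \<cdot> i) \<in> hom C (Dom C \<sigma>) (Dom C \<tau>)"
    using T by (simp add: hom_def cat_simps)
  ultimately show "\<exists>h \<in> hom C (Dom C \<sigma>) (Dom C \<tau>). \<sigma> = \<tau> \<cdot> h \<and> \<phi> = \<psi> \<cdot> h" by blast
next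
  assume "\<exists>h \<in> hom C (Dom C \<sigma>) (Dom C \<tau>). \<sigma> = \<tau> \<cdot> h \<and> \<phi> = \<psi> \<cdot> h"
  then obtain h where h: "h \<in> hom C (Dom C \<sigma>) (Dom C \<tau>)" "\<sigma> = \<tau> \<cdot> h" "\<phi> = \<psi> \<cdot> h" by blast
  then have "h \<in> S" using S_cancel[of \<tau> h] s t by (auto simp: spans_iff hom_def)
  then show "par_le C S (span_class C S (\<sigma>, \<phi>)) (span_class C S (\<tau>, \<psi>))"
    using h span_class_self[OF s] span_class_self[OF t] unfolding par_le_def by blast
qed

lemma Par_homE:
  assumes "F \<in> hom (Par C S) a b"
  obtains \<sigma> \<phi> where "(\<sigma>, \<phi>) \<in> spans C S" "F = span_class C S (\<sigma>, \<phi>)" "\<sigma> \<in> S" "\<sigma> \<in> Arr C"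
    "\<phi> \<in> Arr C" "Dom C \<phi> = Dom C \<sigma>" "Cod C \<sigma> = a" "Cod C \<phi> = b"
proof -
  obtain \<sigma> \<phi> where s: "(\<sigma>, \<phi>) \<in> spans C S" "F = span_class C S (\<sigma>, \<phi>)"
    using assms Par_ArrE by (auto simp: hom_def)
  then show ?thesis
    using that[OF s] assms S_Arr by (auto simp: hom_def Dom_Par Cod_Par spans_iff)
qed

text \<open>For monotonicity, the arrow comparing two partial maps turns the pullback square of the
  smaller composite into a cone for the larger one; the induced arrow between pullbacks compares the
  composites.\<close>

lemma ordered_category_Par: "ordered_category (Par C S)"
proof (intro ordered_category.intro category_Par ordered_category_axioms.intro)
  show "le (Par C S) F F" if "F \<in> Arr (Par C S)" for F
  proof -
    have "F \<in> hom (Par C S) (Dom (Par C S) F) (Cod (Par C S) F)" using that by (simp add: hom_def)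
    then obtain \<sigma> \<phi> where s: "(\<sigma>, \<phi>) \<in> spans C S" "F = span_class C S (\<sigma>, \<phi>)" "\<sigma> \<in> Arr C"
      "\<phi> \<in> Arr C" "Dom C \<phi> = Dom C \<sigma>"
      by (rule Par_homE) blast
    then show ?thesis
      using Comp_Ide[of \<sigma>] Comp_Ide[of \<phi>]
      by (auto simp: Par_simps(5) par_le_class_iff Dom_Ob intro!: bexI[of _ "Ide C (Dom C \<sigma>)"] Ide_hom)
  qed
  show "le (Par C S) F H"
    if FGH: "F \<in> hom (Par C S) a b" "G \<in> hom (Par C S) a b" "H \<in> hom (Par C S) a b"
      "le (Par C S) F G" "le (Par C S) G H" for F G H a b
  proof -
    obtain \<sigma> \<phi> where F: "(\<sigma>, \<phi>) \<in> spans C S" "F = span_class C S (\<sigma>, \<phi>)"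
      by (rule Par_homE[OF FGH(1)]) blast
    obtain \<tau> \<psi> where G: "(\<tau>, \<psi>) \<in> spans C S" "G = span_class C S (\<tau>, \<psi>)"
      by (rule Par_homE[OF FGH(2)]) blast
    obtain \<rho> \<chi> where H: "(\<rho>, \<chi>) \<in> spans C S" "H = span_class C S (\<rho>, \<chi>)"
      "\<rho> \<in> Arr C" "\<chi> \<in> Arr C" "Dom C \<chi> = Dom C \<rho>"
      by (rule Par_homE[OF FGH(3)]) blast
    obtain h where h: "h \<in> hom C (Dom C \<sigma>) (Dom C \<tau>)" "\<sigma> = \<tau> \<cdot> h" "\<phi> = \<psi> \<cdot> h"
      using FGH(4) F G by (auto simp: Par_simps(5) par_le_class_iff)
    obtain k where k: "k \<in> hom C (Dom C \<tau>) (Dom C \<rho>)" "\<tau> = \<rho> \<cdot> k" "\<psi> = \<chi> \<cdot> k"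
      using FGH(5) G H by (auto simp: Par_simps(5) par_le_class_iff)
    have T: "h \<in> Arr C" "k \<in> Arr C" "Dom C h = Dom C \<sigma>" "Cod C h = Dom C k" "Cod C k = Dom C \<rho>"
      using h(1) k(1) by (auto simp: hom_def)
    have "\<sigma> = \<rho> \<cdot> (k \<cdot> h)" "\<phi> = \<chi> \<cdot> (k \<cdot> h)"
      using h(2,3) k(2,3) H T Comp_assoc[of h k] by simp_all
    moreover have "k \<cdot> h \<in> hom C (Dom C \<sigma>) (Dom C \<rho>)" using T by (simp add: hom_def cat_simps)
    ultimately have "\<exists>h \<in> hom C (Dom C \<sigma>) (Dom C \<rho>). \<sigma> = \<rho> \<cdot> h \<and> \<phi> = \<chi> \<cdot> h" by blast
    then show ?thesis using F H by (simp add: Par_simps(5) par_le_class_iff)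
  qed
  show "le (Par C S) (Comp (Par C S) H F) (Comp (Par C S) H G)"
    if FGH: "F \<in> hom (Par C S) a b" "G \<in> hom (Par C S) a b" "H \<in> hom (Par C S) b c"
      "le (Par C S) F G" for F G H a b c
  proof -
    obtain \<sigma> \<phi> where F: "(\<sigma>, \<phi>) \<in> spans C S" "F = span_class C S (\<sigma>, \<phi>)" "\<sigma> \<in> Arr C" "\<phi> \<in> Arr C"
      "Dom C \<phi> = Dom C \<sigma>" "Cod C \<phi> = b"
      by (rule Par_homE[OF FGH(1)]) blast
    obtain \<tau> \<psi> where G: "(\<tau>, \<psi>) \<in> spans C S" "G = span_class C S (\<tau>, \<psi>)" "\<tau> \<in> Arr C" "\<psi> \<in> Arr C"
      "Dom C \<psi> = Dom C \<tau>" "Cod C \<psi> = b"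
      by (rule Par_homE[OF FGH(2)]) blast
    obtain \<rho> \<chi> where H: "(\<rho>, \<chi>) \<in> spans C S" "H = span_class C S (\<rho>, \<chi>)" "\<rho> \<in> S"
      "\<rho> \<in> Arr C" "\<chi> \<in> Arr C" "Dom C \<chi> = Dom C \<rho>" "Cod C \<rho> = b"
      by (rule Par_homE[OF FGH(3)]) blast
    obtain h where h: "h \<in> hom C (Dom C \<sigma>) (Dom C \<tau>)" "\<sigma> = \<tau> \<cdot> h" "\<phi> = \<psi> \<cdot> h"
      using FGH(4) F G by (auto simp: Par_simps(5) par_le_class_iff)
    have T: "h \<in> Arr C" "Dom C h = Dom C \<sigma>" "Cod C h = Dom C \<tau>" using h(1) by (auto simp: hom_def)
    obtain p q where pb: "is_pullback C p q \<phi> \<rho>" using ex_pullback[of \<rho> \<phi>] F H by auto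
    obtain p' q' where pb': "is_pullback C p' q' \<psi> \<rho>" using ex_pullback[of \<rho> \<psi>] G H by auto
    note D = pullbackD[OF pb] and D' = pullbackD[OF pb']
    \<comment> \<open>The cone over \<open>\<psi>\<close> and \<open>\<rho>\<close> consists of
      \<open>h \<cdot> p\<close> and \<open>q\<close>, since \<open>\<psi> \<cdot> h\<close> is
      \<open>\<phi>\<close>.\<close>
    have e: "\<psi> \<cdot> (h \<cdot> p) = \<rho> \<cdot> q" "\<sigma> \<cdot> p = \<tau> \<cdot> (h \<cdot> p)"
      using h(2,3) D T F G Comp_assoc[of p h] by simp_all
    have hp: "h \<cdot> p \<in> Arr C" "Dom C (h \<cdot> p) = Dom C q" "Cod C (h \<cdot> p) = Dom C \<psi>"
      using D T F G by (simp_all add: cat_simps)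
    obtain k where k: "k \<in> Arr C" "Dom C k = Dom C (h \<cdot> p)" "Cod C k = Dom C p'" "p' \<cdot> k = h \<cdot> p"
      "q' \<cdot> k = q"
      using pullback_lift[OF pb' hp(1) D(4) hp(2,3) D(8) e(1)] by blast
    have "\<sigma> \<cdot> p = (\<tau> \<cdot> p') \<cdot> k" "\<chi> \<cdot> q = (\<chi> \<cdot> q') \<cdot> k"
      using e(2) k D D' G H Comp_assoc[of k p' \<tau>] Comp_assoc[of k q' \<chi>] by simp_all
    moreover have "k \<in> hom C (Dom C (\<sigma> \<cdot> p)) (Dom C (\<tau> \<cdot> p'))"
      using k hp D D' F G by (simp add: hom_def cat_simps)
    ultimately show ?thesis
      using F(1,2) G(1,2) H(1,2) comp_span[OF F(1) H(1) pb] comp_span[OF G(1) H(1) pb']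
      by (auto simp: Par_simps(3,5) Par_Comp_class[OF F(1) H(1) pb] Par_Comp_class[OF G(1) H(1) pb']
          par_le_class_iff)
  qed
  show "le (Par C S) (Comp (Par C S) F H) (Comp (Par C S) G H)"
    if FGH: "F \<in> hom (Par C S) b c" "G \<in> hom (Par C S) b c" "H \<in> hom (Par C S) a b"
      "le (Par C S) F G" for F G H a b c
  proof -
    obtain \<sigma> \<phi> where F: "(\<sigma>, \<phi>) \<in> spans C S" "F = span_class C S (\<sigma>, \<phi>)" "\<sigma> \<in> S" "\<sigma> \<in> Arr C"
      "\<phi> \<in> Arr C" "Dom C \<phi> = Dom C \<sigma>" "Cod C \<sigma> = b"
      by (rule Par_homE[OF FGH(1)]) blast
    obtain \<tau> \<psi> where G: "(\<tau>, \<psi>) \<in> spans C S" "G = span_class C S (\<tau>, \<psi>)" "\<tau> \<in> S" "\<tau> \<in> Arr C"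
      "\<psi> \<in> Arr C" "Dom C \<psi> = Dom C \<tau>" "Cod C \<tau> = b"
      by (rule Par_homE[OF FGH(2)]) blast
    obtain \<rho> \<chi> where H: "(\<rho>, \<chi>) \<in> spans C S" "H = span_class C S (\<rho>, \<chi>)"
      "\<rho> \<in> Arr C" "\<chi> \<in> Arr C" "Dom C \<chi> = Dom C \<rho>" "Cod C \<chi> = b"
      by (rule Par_homE[OF FGH(3)]) blast
    obtain h where h: "h \<in> hom C (Dom C \<sigma>) (Dom C \<tau>)" "\<sigma> = \<tau> \<cdot> h" "\<phi> = \<psi> \<cdot> h"
      using FGH(4) F G by (auto simp: Par_simps(5) par_le_class_iff)
    have T: "h \<in> Arr C" "Dom C h = Dom C \<sigma>" "Cod C h = Dom C \<tau>" using h(1) by (auto simp: hom_def)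
    obtain p q where pb: "is_pullback C p q \<chi> \<sigma>" using ex_pullback[of \<sigma> \<chi>] F H by auto
    obtain p' q' where pb': "is_pullback C p' q' \<chi> \<tau>" using ex_pullback[of \<tau> \<chi>] G H by auto
    note D = pullbackD[OF pb] and D' = pullbackD[OF pb']
    \<comment> \<open>Now the subobject being pulled back changes, so \<open>h\<close> acts on the
      other leg: the cone over \<open>\<chi>\<close> and \<open>\<tau>\<close> is \<open>p\<close>
      and \<open>h \<cdot> q\<close>.\<close>
    have e: "\<chi> \<cdot> p = \<tau> \<cdot> (h \<cdot> q)" "\<phi> \<cdot> q = \<psi> \<cdot> (h \<cdot> q)"
      using h(2,3) D T F G Comp_assoc[of q h] by simp_all
    have hq: "h \<cdot> q \<in> Arr C" "Dom C p = Dom C (h \<cdot> q)" "Cod C (h \<cdot> q) = Dom C \<tau>"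
      using D T F G by (simp_all add: cat_simps)
    obtain k where k: "k \<in> Arr C" "Dom C k = Dom C p" "Cod C k = Dom C p'" "p' \<cdot> k = p"
      "q' \<cdot> k = h \<cdot> q"
      using pullback_lift[OF pb' D(3) hq(1,2) D(7) hq(3) e(1)] by blast
    have "\<rho> \<cdot> p = (\<rho> \<cdot> p') \<cdot> k" "\<phi> \<cdot> q = (\<psi> \<cdot> q') \<cdot> k"
      using e(2) k D D' G H Comp_assoc[of k p' \<rho>] Comp_assoc[of k q' \<psi>] by simp_all
    moreover have "k \<in> hom C (Dom C (\<rho> \<cdot> p)) (Dom C (\<rho> \<cdot> p'))"
      using k D D' H by (simp add: hom_def cat_simps)
    ultimately show ?thesis
      using F(1,2) G(1,2) H(1,2) comp_span[OF H(1) F(1) pb] comp_span[OF H(1) G(1) pb']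
      by (auto simp: Par_simps(3,5) Par_Comp_class[OF H(1) F(1) pb] Par_Comp_class[OF H(1) G(1) pb']
          par_le_class_iff)
  qed
qed

section \<open>Total maps among the partial maps\<close>

lemma of_arr_span: "m \<in> Arr C \<Longrightarrow> (Ide C (Dom C m), m) \<in> spans C S"
  by (simp add: spans_iff S_Ide Dom_Ob Dom_Ide)

lemma of_arr_hom: "m \<in> Arr C \<Longrightarrow> of_arr C S m \<in> hom (Par C S) (Dom C m) (Cod C m)"
  using of_arr_span[of m]
  by (simp add: of_arr_def hom_def span_class_Arr Dom_Par Cod_Par Cod_Ide Dom_Ob)

lemma of_arr_eq_iff: "m \<in> Arr C \<Longrightarrow> n \<in> Arr C \<Longrightarrow> of_arr C S m = of_arr C S n \<longleftrightarrow> m = n"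
  using bij_betw_of_arr by (auto simp: bij_betw_def dest: inj_onD)

lemma in_Tot_iff: "m \<in> Tot C S K \<longleftrightarrow> m \<in> Arr C \<and> of_arr C S m \<in> K"
proof -
  have "total_par C (of_arr C S m)" if "m \<in> Arr C"
    using bij_betw_of_arr that by (auto simp: bij_betw_def)
  then show ?thesis by (auto simp: Tot_def)
qed

text \<open>The pullback of an identity is an identity, so following a partial map by a total one
  leaves its domain of definition unchanged.\<close>

lemma Par_Comp_of_arr_left:
  assumes "(\<sigma>, \<phi>) \<in> spans C S" "m \<in> Arr C" "Dom C m = Cod C \<phi>"
  shows "of_arr C S m \<cdot>\<^bsub>Par C S\<^esub> span_class C S (\<sigma>, \<phi>) = span_class C S (\<sigma>, m \<cdot> \<phi>)"
proof -
  have A: "\<phi> \<in> Arr C" "\<sigma> \<in> Arr C" "Dom C \<phi> = Dom C \<sigma>" using assms(1) S_Arr by (auto simp: spans_iff)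
  have "is_pullback C (Ide C (Dom C \<phi>)) \<phi> \<phi> (Ide C (Dom C m))"
    using pullback_Ide[OF A(1)] assms(3) by simp
  then show ?thesis
    using Par_Comp_class[OF assms(1) of_arr_span[OF assms(2)]] A Comp_Ide[of \<sigma>]
    by (simp add: Par_simps(3) of_arr_def)
qed

lemma of_arr_Comp:
  assumes "m \<in> Arr C" "n \<in> Arr C" "Dom C n = Cod C m"
  shows "of_arr C S (n \<cdot> m) = of_arr C S n \<cdot>\<^bsub>Par C S\<^esub> of_arr C S m"
  using Par_Comp_of_arr_left[OF of_arr_span[OF assms(1)] assms(2,3)] assms
  by (simp add: of_arr_def Dom_Comp)

lemma of_arr_Ide: "a \<in> Ob C \<Longrightarrow> of_arr C S (Ide C a) = Ide (Par C S) a"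
  by (simp add: of_arr_def Dom_Ide Par_simps(4))

text \<open>This is the triviality of the kernel pair of a monomorphism.\<close>

lemma pullback_S_self:
  assumes "\<sigma> \<in> S"
  shows "is_pullback C (Ide C (Dom C \<sigma>)) (Ide C (Dom C \<sigma>)) \<sigma> \<sigma>"
proof (rule pullbackI)
  note A = S_Arr[OF assms]
  show "\<exists>h \<in> Arr C. Dom C h = Dom C x \<and> Cod C h = Dom C (Ide C (Dom C \<sigma>)) \<and>
      Ide C (Dom C \<sigma>) \<cdot> h = x \<and> Ide C (Dom C \<sigma>) \<cdot> h = y"
    if x: "x \<in> Arr C" "y \<in> Arr C" "Dom C x = Dom C y" "Cod C x = Dom C \<sigma>" "Cod C y = Dom C \<sigma>"
      "\<sigma> \<cdot> x = \<sigma> \<cdot> y" for x y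
  proof -
    have "x \<in> hom C (Dom C x) (Dom C \<sigma>)" "y \<in> hom C (Dom C x) (Dom C \<sigma>)"
      using x by (auto simp: hom_def)
    then have "x = y" using S_monic[OF assms] x(6) unfolding monic_def by blast
    then show ?thesis using x A Ide_Comp[of x] by (auto simp: Dom_Ide Dom_Ob)
  qed
  show "h = k" if "h \<in> Arr C" "k \<in> Arr C" "Cod C h = Dom C (Ide C (Dom C \<sigma>))"
    "Cod C k = Dom C (Ide C (Dom C \<sigma>))" "Ide C (Dom C \<sigma>) \<cdot> h = Ide C (Dom C \<sigma>) \<cdot> k" for h k
    using that A Ide_Comp[of h] Ide_Comp[of k] by (simp add: cat_simps)
qed (use S_Arr[OF assms] in \<open>simp_all add: cat_simps\<close>)

text \<open>The span \<open>(\<sigma>, 1)\<close> is the partial inverse of \<open>\<sigma>\<close>,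
  defined on the subobject \<open>\<sigma>\<close> itself. Hence every arrow of \<open>S\<close>
  becomes a split monomorphism among partial maps, which is the source of the retracts used for
  factorisations.\<close>

lemma restriction_of_arr:
  assumes "\<sigma> \<in> S"
  shows "span_class C S (\<sigma>, Ide C (Dom C \<sigma>)) \<cdot>\<^bsub>Par C S\<^esub> of_arr C S \<sigma> = Ide (Par C S) (Dom C \<sigma>)"
proof -
  note A = S_Arr[OF assms]
  have t: "(\<sigma>, Ide C (Dom C \<sigma>)) \<in> spans C S"
    using assms A by (simp add: spans_iff cat_simps)
  have "Ide C (Dom C \<sigma>) \<cdot> Ide C (Dom C \<sigma>) = Ide C (Dom C \<sigma>)"
    using Comp_Ide[of "Ide C (Dom C \<sigma>)"] A by (simp add: Ide_Arr Dom_Ide Dom_Ob)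
  then show ?thesis
    using Par_Comp_class[OF of_arr_span[OF A] t pullback_S_self[OF assms]]
    by (simp add: Par_simps(3,4) of_arr_def)
qed

text \<open>A span \<open>(\<tau>, \<psi>)\<close> above the total map comes with \<open>h\<close>
  such that \<open>\<tau> \<cdot> h\<close> is an identity. A monomorphism with a right inverse is
  invertible, and \<open>\<tau>\<close> is then an isomorphism of spans from
  \<open>(\<tau>, \<psi>)\<close> to \<open>(1, m)\<close>.\<close>

lemma of_arr_maximal:
  assumes "m \<in> Arr C" "G \<in> Arr (Par C S)" "par_le C S (of_arr C S m) G"
  shows "G = of_arr C S m"
proof -
  obtain \<tau> \<psi> where G: "(\<tau>, \<psi>) \<in> spans C S" "G = span_class C S (\<tau>, \<psi>)" using assms(2) by (rule Par_ArrE)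
  have A: "\<tau> \<in> S" "\<tau> \<in> Arr C" "\<psi> \<in> Arr C" "Dom C \<psi> = Dom C \<tau>"
    using G S_Arr by (auto simp: spans_iff)
  obtain h where h: "h \<in> Arr C" "Dom C h = Dom C m" "Cod C h = Dom C \<tau>"
    "Ide C (Dom C m) = \<tau> \<cdot> h" "m = \<psi> \<cdot> h"
    using assms(3) unfolding of_arr_def G(2) par_le_class_iff[OF of_arr_span[OF assms(1)] G(1)]
    by (auto simp: hom_def Dom_Ide Dom_Ob assms(1))
  \<comment> \<open>Nothing is assumed about the source of \<open>G\<close>; the equation for the
    identity forces it to be that of \<open>m\<close>.\<close>
  have "Cod C \<tau> = Cod C (\<tau> \<cdot> h)" using h(1,3) A by (simp add: Cod_Comp)
  then have ct: "Cod C \<tau> = Dom C m" unfolding h(4)[symmetric] by (simp add: Cod_Ide Dom_Ob assms(1))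
  have "\<tau> \<cdot> (h \<cdot> \<tau>) = \<tau> \<cdot> Ide C (Dom C \<tau>)"
    using Comp_assoc[of \<tau> h \<tau>] h A ct Ide_Comp[of \<tau>] Comp_Ide[of \<tau>] by simp
  moreover have "h \<cdot> \<tau> \<in> hom C (Dom C \<tau>) (Dom C \<tau>)"
    using h A ct by (simp add: hom_def cat_simps)
  moreover have "Ide C (Dom C \<tau>) \<in> hom C (Dom C \<tau>) (Dom C \<tau>)" using A by (simp add: Ide_hom Dom_Ob)
  ultimately have ht: "h \<cdot> \<tau> = Ide C (Dom C \<tau>)" using S_monic[OF A(1)] unfolding monic_def by blast
  have "is_iso C \<tau>" using A h ct ht by (intro is_isoI[where j = h]) auto
  moreover have "\<tau> = Ide C (Dom C m) \<cdot> \<tau>" using Ide_Comp[OF A(2)] ct by simp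
  moreover have "\<psi> = m \<cdot> \<tau>"
    using Comp_assoc[of \<tau> h \<psi>] h A ct ht Comp_Ide[of \<psi>] by simp
  moreover have "\<tau> \<in> hom C (Dom C \<tau>) (Dom C (Ide C (Dom C m)))"
    using A ct assms(1) by (simp add: hom_def Dom_Ide Dom_Ob)
  ultimately have "((\<tau>, \<psi>), (Ide C (Dom C m), m)) \<in> span_iso C S"
    unfolding span_iso_iff using G(1) of_arr_span[OF assms(1)] by blast
  then show ?thesis
    unfolding G(2) of_arr_def using span_class_iff[OF G(1) of_arr_span[OF assms(1)]] by blast
qed

text \<open>If a composite is defined everywhere, then its first factor is defined everywhere and
  lands in the domain of definition of the second. It is used for factorisations of total maps and
  for the totality of fillers.\<close>

lemma of_arr_eq_CompE:
  assumes f: "f \<in> Arr C" and l: "l \<in> Arr (Par C S)" and r: "r \<in> Arr (Par C S)"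
    and lr: "Dom (Par C S) r = Cod (Par C S) l" and e: "of_arr C S f = r \<cdot>\<^bsub>Par C S\<^esub> l"
  obtains \<sigma> \<phi> l' where "(\<sigma>, \<phi>) \<in> spans C S" "r = span_class C S (\<sigma>, \<phi>)"
    "l' \<in> hom C (Dom C f) (Dom C \<sigma>)" "l = of_arr C S (\<sigma> \<cdot> l')" "f = \<phi> \<cdot> l'"
proof -
  obtain \<tau> \<psi> where L: "(\<tau>, \<psi>) \<in> spans C S" "l = span_class C S (\<tau>, \<psi>)" using l by (rule Par_ArrE)
  obtain \<sigma> \<phi> where R: "(\<sigma>, \<phi>) \<in> spans C S" "r = span_class C S (\<sigma>, \<phi>)" using r by (rule Par_ArrE)
  have A: "\<sigma> \<in> S" "\<sigma> \<in> Arr C" "\<phi> \<in> Arr C" "Dom C \<phi> = Dom C \<sigma>"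
    "\<tau> \<in> Arr C" "\<psi> \<in> Arr C" "Dom C \<psi> = Dom C \<tau>"
    using L R S_Arr by (auto simp: spans_iff)
  have "Cod C \<psi> = Cod C \<sigma>" using lr L R by (simp add: Dom_Par Cod_Par)
  then obtain p q where pb: "is_pullback C p q \<psi> \<sigma>" using ex_pullback[of \<sigma> \<psi>] A by auto
  note D = pullbackD[OF pb]
  have "span_class C S (Ide C (Dom C f), f) = span_class C S (\<tau> \<cdot> p, \<phi> \<cdot> q)"
    using e L R Par_Comp_class[OF L(1) R(1) pb] by (simp add: of_arr_def Par_simps(3))
  then obtain i where i0: "i \<in> hom C (Dom C (Ide C (Dom C f))) (Dom C (\<tau> \<cdot> p))"
    "Ide C (Dom C f) = \<tau> \<cdot> p \<cdot> i" "f = \<phi> \<cdot> q \<cdot> i"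
    using span_class_iff[OF of_arr_span[OF f] comp_span[OF L(1) R(1) pb]]
    by (auto simp: span_iso_iff)
  have i: "i \<in> Arr C" "Dom C i = Dom C f" "Cod C i = Dom C p"
    using i0(1) f A D by (auto simp: hom_def Dom_Ide Dom_Ob Dom_Comp)
  have e1: "Ide C (Dom C f) = \<tau> \<cdot> (p \<cdot> i)" "f = \<phi> \<cdot> (q \<cdot> i)"
    using i0 i A D Comp_assoc[of i p \<tau>] Comp_assoc[of i q \<phi>] by simp_all
  have e2: "\<sigma> \<cdot> (q \<cdot> i) = \<psi> \<cdot> (p \<cdot> i)"
    using i A D Comp_assoc[of i p \<psi>] Comp_assoc[of i q \<sigma>] by simp
  have m: "\<sigma> \<cdot> (q \<cdot> i) \<in> Arr C" "Dom C (\<sigma> \<cdot> (q \<cdot> i)) = Dom C f"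
    using i A D by (simp_all add: cat_simps)
  \<comment> \<open>The arrow \<open>p \<cdot> i\<close> witnesses that the total map
    \<open>\<sigma> \<cdot> (q \<cdot> i)\<close> lies below \<open>l\<close>; maximality makes them
    equal, and \<open>l'\<close> is \<open>q \<cdot> i\<close>.\<close>
  have "p \<cdot> i \<in> hom C (Dom C (Ide C (Dom C f))) (Dom C \<tau>)"
    using i A D f by (simp add: hom_def cat_simps)
  then have "par_le C S (of_arr C S (\<sigma> \<cdot> (q \<cdot> i))) l"
    unfolding of_arr_def L(2) m(2) par_le_class_iff[OF of_arr_span[OF m(1), unfolded m(2)] L(1)]
    using e1(1) e2 by blast
  then have "l = of_arr C S (\<sigma> \<cdot> (q \<cdot> i))" by (rule of_arr_maximal[OF m(1) l])
  moreover have "q \<cdot> i \<in> hom C (Dom C f) (Dom C \<sigma>)" using i A D by (simp add: hom_def cat_simps)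
  ultimately show ?thesis using that R e1(2) by blast
qed

section \<open>Fillers, factorisations and the retract argument for total maps\<close>

lemma Tot_orth:
  assumes "f \<in> Arr C" "g \<in> Arr C" "oplax_orth (Par C S) (of_arr C S f) (of_arr C S g)"
  shows "weak_orth C f g"
  unfolding weak_orth_def
proof (intro ballI impI)
  interpret P: ordered_category "Par C S" by (rule ordered_category_Par)
  fix u v assume u: "u \<in> hom C (Dom C f) (Dom C g)" and v: "v \<in> hom C (Cod C f) (Cod C g)"
    and e: "v \<cdot> f = g \<cdot> u"
  have A: "u \<in> Arr C" "Dom C u = Dom C f" "Cod C u = Dom C g"
    "v \<in> Arr C" "Dom C v = Cod C f" "Cod C v = Cod C g" using u v by (auto simp: hom_def)
  note F = of_arr_hom[OF assms(1)] and G = of_arr_hom[OF assms(2)]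
    and U = of_arr_hom[OF A(1)] and V = of_arr_hom[OF A(4)]
  have "of_arr C S v \<cdot>\<^bsub>Par C S\<^esub> of_arr C S f = of_arr C S g \<cdot>\<^bsub>Par C S\<^esub> of_arr C S u"
    using of_arr_Comp A assms e by metis
  moreover have "of_arr C S g \<cdot>\<^bsub>Par C S\<^esub> of_arr C S u \<in> Arr (Par C S)"
    using P.Comp_in_hom[OF U G[folded A(3)]] by (simp add: hom_def)
  ultimately have "oplax_square (Par C S) (of_arr C S f) (of_arr C S g) (of_arr C S u) (of_arr C S v)"
    using A F G U V P.le_refl by (simp add: oplax_square_def hom_def)
  then obtain d where d: "d \<in> hom (Par C S) (Cod C f) (Dom C g)"
    "par_le C S (d \<cdot>\<^bsub>Par C S\<^esub> of_arr C S f) (of_arr C S u)"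
    "par_le C S (of_arr C S v) (of_arr C S g \<cdot>\<^bsub>Par C S\<^esub> d)"
    using assms(3) F G by (auto simp: oplax_orth_def hom_def Par_simps(5))
  \<comment> \<open>This triangle comes first because the total map \<open>v\<close> is on its
    smaller side, where maximality applies. In the other triangle the smaller side
    \<open>d f\<close> is known to be total only once \<open>d\<close> is.\<close>
  have gd: "of_arr C S v = of_arr C S g \<cdot>\<^bsub>Par C S\<^esub> d"
    using of_arr_maximal[OF A(4) _ d(3)] P.Comp_in_hom[OF d(1) G] by (simp add: hom_def)
  then obtain d' where d': "d' \<in> Arr C" "d = of_arr C S d'"
  proof (rule of_arr_eq_CompE[OF A(4), rotated 3])
    fix \<sigma> \<phi> l' assume "(\<sigma>, \<phi>) \<in> spans C S" "l' \<in> hom C (Dom C v) (Dom C \<sigma>)" "d = of_arr C S (\<sigma> \<cdot> l')"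
    then show ?thesis using that[of "\<sigma> \<cdot> l'"] S_Arr by (auto simp: spans_iff hom_def Comp_Arr)
  qed (use d(1) G in \<open>auto simp: hom_def\<close>)
  have T: "Dom C d' = Cod C f" "Cod C d' = Dom C g"
    using of_arr_hom[OF d'(1)] d(1) d'(2) by (auto simp: hom_def)
  have "of_arr C S (d' \<cdot> f) = of_arr C S u"
    using d(2) of_arr_maximal[of "d' \<cdot> f" "of_arr C S u"] d' T assms U of_arr_Comp[of f d']
    by (simp add: hom_def Comp_Arr)
  then have "d' \<cdot> f = u" using of_arr_eq_iff d' T A assms by (simp add: Comp_Arr)
  moreover have "of_arr C S v = of_arr C S (g \<cdot> d')"
    using gd d' T assms by (simp add: of_arr_Comp)
  then have "g \<cdot> d' = v" using of_arr_eq_iff d' T A assms by (simp add: Comp_Arr)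
  ultimately show "\<exists>d \<in> hom C (Cod C f) (Dom C g). d \<cdot> f = u \<and> g \<cdot> d = v"
    using d' T by (auto simp: hom_def)
qed

text \<open>The right factor \<open>r\<close> obtained among partial maps may fail to be total;
  replacing the middle object by the domain of definition of \<open>r\<close> repairs this without
  leaving the two classes.\<close>

lemma Tot_factorisation:
  assumes W: "oplax_weak_fact_system (Par C S) L R" and f: "f \<in> Arr C"
  obtains l r where "l \<in> Tot C S L" "r \<in> Tot C S R" "l \<in> Arr C" "r \<in> Arr C" "Dom C r = Cod C l" "f = r \<cdot> l"
proof -
  interpret P: ordered_category "Par C S" by (rule ordered_category_Par)
  have "of_arr C S f \<in> Arr (Par C S)" using of_arr_hom[OF f] by (simp add: hom_def)
  then obtain l r where l: "l \<in> L" "l \<in> Arr (Par C S)" and r: "r \<in> R" "r \<in> Arr (Par C S)"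
    and lr: "Dom (Par C S) r = Cod (Par C S) l" "of_arr C S f = r \<cdot>\<^bsub>Par C S\<^esub> l"
    using P.oplax_weak_fact_systemD(6,1,2)[OF W] by meson
  obtain \<sigma> \<phi> m where s: "(\<sigma>, \<phi>) \<in> spans C S" and re: "r = span_class C S (\<sigma>, \<phi>)"
    and m0: "m \<in> hom C (Dom C f) (Dom C \<sigma>)" and le: "l = of_arr C S (\<sigma> \<cdot> m)" and fe: "f = \<phi> \<cdot> m"
    using of_arr_eq_CompE[OF f l(2) r(2) lr] .
  have A: "\<sigma> \<in> S" "\<sigma> \<in> Arr C" "\<phi> \<in> Arr C" "Dom C \<phi> = Dom C \<sigma>" "m \<in> Arr C" "Cod C m = Dom C \<sigma>"
    using s m0 S_Arr by (auto simp: spans_iff hom_def)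
  \<comment> \<open>The partial inverse of \<open>\<sigma>\<close>. The single equation
    \<open>t \<sigma> = 1\<close> is the retract identity for both classes.\<close>
  define t where "t = span_class C S (\<sigma>, Ide C (Dom C \<sigma>))"
  have ts: "(\<sigma>, Ide C (Dom C \<sigma>)) \<in> spans C S" using A by (simp add: spans_iff cat_simps)
  have t: "t \<in> hom (Par C S) (Cod C \<sigma>) (Dom C \<sigma>)"
    using ts A by (simp add: t_def hom_def span_class_Arr Dom_Par Cod_Par cat_simps)
  note hs = of_arr_hom[OF A(2)] and hm = of_arr_hom[OF A(5), unfolded A(6)]
    and hp = of_arr_hom[OF A(3), unfolded A(4)]
  have t1: "t \<cdot>\<^bsub>Par C S\<^esub> of_arr C S \<sigma> = Ide (Par C S) (Dom C \<sigma>)"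
    unfolding t_def by (rule restriction_of_arr[OF A(1)])
  have rt: "r = of_arr C S \<phi> \<cdot>\<^bsub>Par C S\<^esub> t"
    unfolding re t_def using Par_Comp_of_arr_left[OF ts A(3)] A Comp_Ide[of \<phi>] by (simp add: cat_simps)
  have lm: "l = of_arr C S \<sigma> \<cdot>\<^bsub>Par C S\<^esub> of_arr C S m"
    unfolding le using A by (simp add: of_arr_Comp)
  have rs: "of_arr C S \<phi> = r \<cdot>\<^bsub>Par C S\<^esub> of_arr C S \<sigma>"
    using P.hom_assoc[OF hs t hp] t1 P.Comp_Ide[of "of_arr C S \<phi>"] hp by (simp add: rt hom_def)
  have tl: "t \<cdot>\<^bsub>Par C S\<^esub> l = of_arr C S m"
    using P.hom_assoc[OF hm hs t] t1 P.Ide_Comp[of "of_arr C S m"] hm by (simp add: lm hom_def)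
  \<comment> \<open>The roles of \<open>\<sigma>\<close> and \<open>t\<close> are exchanged between
    the classes: \<open>\<phi> = r \<sigma>\<close> and \<open>r = \<phi> t\<close> on the right,
    \<open>m = t l\<close> and \<open>l = \<sigma> m\<close> on the left.\<close>
  have "of_arr C S \<phi> \<in> R"
    using P.oplax_right_class_retract[OF W r(1) P.Comp_in_hom[OF t hp, folded rt] hp hs t rs rt t1] .
  moreover have "of_arr C S m \<in> L"
    using P.oplax_left_class_retract[OF W l(1) P.Comp_in_hom[OF hm hs, folded lm] hm t hs tl lm[symmetric] t1] .
  ultimately show ?thesis using that[of m \<phi>] A fe by (simp add: in_Tot_iff)
qed

lemma weak_fact_system_Tot:
  assumes W: "oplax_weak_fact_system (Par C S) L R"
  shows "weak_fact_system C (Tot C S L) (Tot C S R)"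
proof -
  interpret P: ordered_category "Par C S" by (rule ordered_category_Par)
  have orth: "weak_orth C f g" if "f \<in> Tot C S L" "g \<in> Tot C S R" for f g
  proof -
    have "f \<in> Arr C" "of_arr C S f \<in> L" "g \<in> Arr C" "of_arr C S g \<in> R"
      using that unfolding in_Tot_iff by blast+
    then show ?thesis using Tot_orth P.oplax_weak_fact_systemD(3)[OF W] by blast
  qed
  have right: "g \<in> Tot C S R" if g: "g \<in> Arr C" and o: "\<And>f. f \<in> Tot C S L \<Longrightarrow> weak_orth C f g" for g
  proof -
    obtain l r where lr: "l \<in> Tot C S L" "r \<in> Tot C S R" "l \<in> Arr C" "r \<in> Arr C"
      "Dom C r = Cod C l" "g = r \<cdot> l" using Tot_factorisation[OF W g] .
    have T: "Dom C g = Dom C l" "Cod C g = Cod C r" using lr by (simp_all add: cat_simps)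
    \<comment> \<open>The square from \<open>l\<close> to \<open>g\<close> with an identity on top
      and \<open>r\<close> below has a filler \<open>d\<close>, which exhibits \<open>g\<close> as a
      retract of \<open>r\<close> through \<open>l\<close>.\<close>
    have "Ide C (Dom C g) \<in> hom C (Dom C l) (Dom C g)" "r \<in> hom C (Cod C l) (Cod C g)"
      "r \<cdot> l = g \<cdot> Ide C (Dom C g)"
      using lr T g Ide_hom[of "Dom C l"] Comp_Ide[OF g] by (auto simp: hom_def Dom_Ob)
    then obtain d where d: "d \<in> hom C (Cod C l) (Dom C g)" "d \<cdot> l = Ide C (Dom C g)" "g \<cdot> d = r"
      using o[OF lr(1)] unfolding weak_orth_def by blast
    have D: "d \<in> Arr C" "Dom C d = Cod C l" "Cod C d = Dom C g" using d by (auto simp: hom_def)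
    have "of_arr C S g \<in> R"
    proof (rule P.oplax_right_class_retract[OF W])
      show "of_arr C S r \<in> R" using lr by (simp add: in_Tot_iff)
      show "of_arr C S r \<in> hom (Par C S) (Cod C l) (Cod C g)" using of_arr_hom[OF lr(4)] lr T by simp
      show "of_arr C S g \<in> hom (Par C S) (Dom C g) (Cod C g)" using of_arr_hom[OF g] .
      show "of_arr C S l \<in> hom (Par C S) (Dom C g) (Cod C l)" using of_arr_hom[OF lr(3)] T by simp
      show "of_arr C S d \<in> hom (Par C S) (Cod C l) (Dom C g)" using of_arr_hom[OF D(1)] D by simp
      show "of_arr C S g = of_arr C S r \<cdot>\<^bsub>Par C S\<^esub> of_arr C S l" using lr by (simp add: of_arr_Comp)
      show "of_arr C S r = of_arr C S g \<cdot>\<^bsub>Par C S\<^esub> of_arr C S d"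
        using of_arr_Comp[of d g] D d g by simp
      show "of_arr C S d \<cdot>\<^bsub>Par C S\<^esub> of_arr C S l = Ide (Par C S) (Dom C g)"
        using of_arr_Comp[of l d] lr D d g by (simp add: of_arr_Ide Dom_Ob)
    qed
    then show ?thesis using g by (simp add: in_Tot_iff)
  qed
  have left: "f \<in> Tot C S L" if f: "f \<in> Arr C" and o: "\<And>g. g \<in> Tot C S R \<Longrightarrow> weak_orth C f g" for f
  proof -
    obtain l r where lr: "l \<in> Tot C S L" "r \<in> Tot C S R" "l \<in> Arr C" "r \<in> Arr C"
      "Dom C r = Cod C l" "f = r \<cdot> l" using Tot_factorisation[OF W f] .
    have T: "Dom C f = Dom C l" "Cod C f = Cod C r" using lr by (simp_all add: cat_simps)
    \<comment> \<open>Dually, the square from \<open>f\<close> to \<open>r\<close> with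
      \<open>l\<close> on top and an identity below has a filler, which exhibits \<open>f\<close> as
      a retract of \<open>l\<close> through \<open>r\<close>.\<close>
    have "l \<in> hom C (Dom C f) (Dom C r)" "Ide C (Cod C f) \<in> hom C (Cod C f) (Cod C r)"
      "Ide C (Cod C f) \<cdot> f = r \<cdot> l"
      using lr T f Ide_hom[of "Cod C r"] Ide_Comp[OF f] by (auto simp: hom_def Cod_Ob)
    then obtain d where d: "d \<in> hom C (Cod C f) (Dom C r)" "d \<cdot> f = l" "r \<cdot> d = Ide C (Cod C f)"
      using o[OF lr(2)] unfolding weak_orth_def by blast
    have D: "d \<in> Arr C" "Dom C d = Cod C f" "Cod C d = Dom C r" using d by (auto simp: hom_def)
    have "of_arr C S f \<in> L"
    proof (rule P.oplax_left_class_retract[OF W])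
      show "of_arr C S l \<in> L" using lr by (simp add: in_Tot_iff)
      show "of_arr C S l \<in> hom (Par C S) (Dom C f) (Cod C l)" using of_arr_hom[OF lr(3)] T by simp
      show "of_arr C S f \<in> hom (Par C S) (Dom C f) (Cod C f)" using of_arr_hom[OF f] .
      show "of_arr C S r \<in> hom (Par C S) (Cod C l) (Cod C f)" using of_arr_hom[OF lr(4)] lr T by simp
      show "of_arr C S d \<in> hom (Par C S) (Cod C f) (Cod C l)" using of_arr_hom[OF D(1)] D lr by simp
      show "of_arr C S r \<cdot>\<^bsub>Par C S\<^esub> of_arr C S l = of_arr C S f" using lr by (simp add: of_arr_Comp)
      show "of_arr C S d \<cdot>\<^bsub>Par C S\<^esub> of_arr C S f = of_arr C S l"
        using of_arr_Comp[of f d] D d f by simp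
      show "of_arr C S r \<cdot>\<^bsub>Par C S\<^esub> of_arr C S d = Ide (Par C S) (Cod C f)"
        using of_arr_Comp[of d r] lr D d f by (simp add: of_arr_Ide Cod_Ob)
    qed
    then show ?thesis using f by (simp add: in_Tot_iff)
  qed
  show ?thesis
    unfolding weak_fact_system_def
  proof (intro conjI ballI)
    show "Tot C S R = {g \<in> Arr C. \<forall>f \<in> Tot C S L. weak_orth C f g}"
      using orth right by (blast dest: in_Tot_iff[THEN iffD1])
    show "Tot C S L = {f \<in> Arr C. \<forall>g \<in> Tot C S R. weak_orth C f g}"
      using orth left by (blast dest: in_Tot_iff[THEN iffD1])
    show "\<exists>l \<in> Tot C S L. \<exists>r \<in> Tot C S R. Dom C r = Cod C l \<and> f = r \<cdot> l" if "f \<in> Arr C" for f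
      using Tot_factorisation[OF W that] by blast
  qed
qed

end

theorem proposition7p12:
  fixes C :: "('o, 'm) cat"
    and S :: "'m set"
    and L R :: "('m \<times> 'm) set set"
  assumes "subobject_class C S"
    and "oplax_weak_fact_system (Par C S) L R"
  shows "weak_fact_system C (Tot C S L) (Tot C S R)"
  using assms by (rule subobject_class.weak_fact_system_Tot)

end
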